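(* Let $b>0$, let $\alpha_0$ be the probability measure on $[-1,1]$ with density $$\alpha_0(d\sigma)=\frac{1}{2B(b,b)}\Bigl(\frac{1+\sigma}{2}\Bigr)^{b-1}\Bigl(1-\frac{1+\sigma}{2}\Bigr)^{b-1}d\sigma,\qquad B(b,b)=\frac{\Gamma(b)^2}{\Gamma(2b)},$$ and let $g(\sigma)=\sigma$. Then $\frac{\partial^3}{\partial t^3}\log\alpha_0(e^{tg})<0$ for all $t>0$, and the smallest natural number $k$ with $\frac{\partial^k}{\partial t^k}\log\alpha_0(e^{tg})\big|_{t=0}<0$ is $k=4$. Consequently, let $W$ be a random variable with values in $(0,\infty)$ and $\mathbb{E}[W^2]<\infty$ such that either $\mathbb{E}[W^4]<\infty$, or there are $\tau\in(3,5]$, $C_W>c_W>0$ and $w_0>1$ with $c_Ww^{-(\tau-1)}\le\mathbb{P}(W>w)\le C_Ww^{-(\tau-1)}$ for all $w>w_0$. Then: - if $\mathbb{E}[W^4]<\infty$: $m^+(\theta,0)\asymp(\theta-\theta_c)^{1/2}$ as $\theta\searrow\theta_c$ and $m^+(\theta_c,h)\asymp h^{1/3}$ as $h\searrow0$; - if the power law holds with $\tau\in(3,5)$: $m^+(\theta,0)\asymp(\theta-\theta_c)^{1/(\tau-3)}$ as $\theta\searrow\theta_c$ and $m^+(\theta_c,h)\asymp h^{1/(\tau-2)}$ as $h\searrow0$; - if the power law holds with $\tau=5$: $m^+(\theta,0)\asymp\bigl(\frac{\theta-\theta_c}{\log(1/(\theta-\theta_c))}\bigr)^{1/2}$ as $\theta\searrow\theta_c$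 and $m^+(\theta_c,h)\asymp\bigl(\frac{h}{\log(1/h)}\bigr)^{1/3}$ as $h\searrow0$.
   Context: For a measure $\mu$ and function $f$, $\mu(f)=\int f\,d\mu$. $\mathbb{E}^{sb}[f(W)]=\mathbb{E}[Wf(W)]/\mathbb{E}[W]$. For $h\ge0$, $m\in\mathbb{R}$, $$\varphi_h(m)=\mathbb{E}^{sb}\left[\frac{\alpha_0(g\,e^{(Wm+h)g})}{\alpha_0(e^{(Wm+h)g})}\right],\qquad 1/\theta_c=\mathbb{E}^{sb}(W)\,\alpha_0(g^2).$$ For $h=0$ and $\theta>\theta_c$, $m^+(\theta,0)$ is the unique positive solution of $m/\theta=\varphi_0(m)$; for $h>0$ and $\theta>0$, $m^+(\theta,h)$ is the unique nonnegative solution of $m/\theta=\varphi_h(m)$. $f\asymp g$ means that $f/g$ is bounded away from $0$ and $\infty$ in the specified limit. *)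

theory Defs
  imports "HOL-Probability.Probability" "HOL-Library.Landau_Symbols"
begin

text \<open>The image of the Beta law with parameters \<open>(b, b)\<close> under \<open>u \<mapsto> 2 * u - 1\<close>,
  as a measure on all of the real line. The value of the density at the endpoints is immaterial.\<close>

definition sym_beta :: "real \<Rightarrow> real measure" where
  "sym_beta b = density lborel (\<lambda>\<sigma>. ennreal (indicator {-1..1} \<sigma> *
     (1 / (2 * Beta b b) * ((1 + \<sigma>) / 2) powr (b - 1) * (1 - (1 + \<sigma>) / 2) powr (b - 1))))"

definition log_mgf :: "real measure \<Rightarrow> real \<Rightarrow> real" where
  "log_mgf \<alpha> t = ln (\<integral>\<sigma>. exp (t * \<sigma>) \<partial>\<alpha>)"

definition sb_expectation :: "'w measure \<Rightarrow> ('w \<Rightarrow> real) \<Rightarrow> (real \<Rightarrow> real) \<Rightarrow> real" where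
  "sb_expectation M W f = (\<integral>\<omega>. W \<omega> * f (W \<omega>) \<partial>M) / (\<integral>\<omega>. W \<omega> \<partial>M)"

definition phi :: "real measure \<Rightarrow> 'w measure \<Rightarrow> ('w \<Rightarrow> real) \<Rightarrow> real \<Rightarrow> real \<Rightarrow> real" where
  "phi \<alpha> M W h m = sb_expectation M W
     (\<lambda>w. (\<integral>\<sigma>. \<sigma> * exp ((w * m + h) * \<sigma>) \<partial>\<alpha>) / (\<integral>\<sigma>. exp ((w * m + h) * \<sigma>) \<partial>\<alpha>))"

definition theta_c :: "real measure \<Rightarrow> 'w measure \<Rightarrow> ('w \<Rightarrow> real) \<Rightarrow> real" where
  "theta_c \<alpha> M W = 1 / (sb_expectation M W (\<lambda>w. w) * (\<integral>\<sigma>. \<sigma>\<^sup>2 \<partial>\<alpha>))"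

text \<open>Only meaningful for \<open>h = 0\<close>, \<open>\<theta> > theta_c \<alpha> M W\<close>, where the trivial solution
  \<open>m = 0\<close> has to be excluded, and for \<open>h > 0\<close>, \<open>\<theta> > 0\<close>.\<close>

definition m_plus :: "real measure \<Rightarrow> 'w measure \<Rightarrow> ('w \<Rightarrow> real) \<Rightarrow> real \<Rightarrow> real \<Rightarrow> real" where
  "m_plus \<alpha> M W \<theta> h =
     (if h = 0 then (THE m. 0 < m \<and> m / \<theta> = phi \<alpha> M W 0 m)
      else (THE m. 0 \<le> m \<and> m / \<theta> = phi \<alpha> M W h m))"

definition power_law_tail :: "'w measure \<Rightarrow> ('w \<Rightarrow> real) \<Rightarrow> real \<Rightarrow> bool" where
  "power_law_tail M W \<tau> \<longleftrightarrow> (\<exists>c C w0. 0 < c \<and> c < C \<and> 1 < w0 \<and>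
     (\<forall>w>w0. c * w powr (-(\<tau> - 1)) \<le> measure M {\<omega> \<in> space M. W \<omega> > w} \<and>
             measure M {\<omega> \<in> space M. W \<omega> > w} \<le> C * w powr (-(\<tau> - 1))))"

end

(* The moment generating function M of the symmetric Beta law satisfies t M'' + 2 b M' = t M, so
   f = M' / M solves the Riccati equation t f' + t f^2 + 2 b f = t. At a first positive zero of f',
   or of f'', the differentiated equation determines the sign of the next derivative, and so f is
   increasing and strictly concave on the positive half-line. In particular f(x) / x decreases,
   which gives uniqueness of the fixed points, and with \<kappa> = f'(0) the defect
   \<kappa> x - f(x) is comparable to min(x, x^3).

   Inserted in the fixed point equation, this comparison shows that \<theta> - \<theta>c is comparable
   to L(m) = E[W^2 min(1, (W m)^2)] at zero field, and h to m L(m) at \<theta> = \<theta>c. The tail of W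
   determines the order of L(m) as m tends to 0, and inverting the relation gives the exponents. *)

theory Submission
  imports Defs "HOL-Real_Asymp.Real_Asymp"
begin

section \<open>The symmetric Beta law\<close>

text \<open>The defect is compared with min(x, x^3) rather than x^3 because E[W^4] may be infinite.
  Only the second moment is always finite, so the cubic behaviour near 0 has to be cut off at linear
  growth, which an average weighted by W can carry. The crossing argument for f'' has a degenerate
  start, since f''(0) = 0. Its sign just right of 0 comes from f'''(0), the fourth cumulant of the
  Beta law, so the strict inequality at order four at the origin is also what starts the proof that
  the third derivative of the log moment generating function is negative for all t > 0. That the
  solutions tend to 0 is not an input. The comparison with L(m), respectively m L(m), holds near the
  critical point whatever the size of m, and both functions are increasing and positive, so their
  tending to 0 forces m to 0. Only then are the asymptotics of L at 0 inserted. At \<tau> = 5 the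
  inversion must also trade ln(1/m) for the logarithm of the small parameter; crude power bounds on
  m suffice for that.\<close>

text \<open>At a first zero a positive derivative would make \<open>u\<close> negative just to the
  left, where it is positive. The start is a condition near 0 instead of a value at 0, so that
  \<open>u\<close> may vanish at 0 itself.\<close>

lemma positive_if_positive_crossings:
  fixes u u' :: "real \<Rightarrow> real"
  assumes der: "\<And>t. t > 0 \<Longrightarrow> (u has_real_derivative u' t) (at t)"
    and near0: "eventually (\<lambda>t. u t > 0) (at_right 0)"
    and cross: "\<And>t. t > 0 \<Longrightarrow> u t = 0 \<Longrightarrow> (\<And>s. 0 < s \<Longrightarrow> s < t \<Longrightarrow> u s > 0) \<Longrightarrow> u' t > 0"
    and "t > 0"
  shows "u t > 0"
proof (rule ccontr)
  assume "\<not> u t > 0"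
  obtain d where d: "d > 0" "\<And>s. 0 < s \<Longrightarrow> s < d \<Longrightarrow> u s > 0"
    using near0 unfolding eventually_at_right_field by auto
  \<comment> \<open>Starting at \<open>d/2\<close> makes \<open>S\<close> compact; no zero is lost,
    as \<open>u\<close> is positive on all of (0, d).\<close>
  define S where "S = {s \<in> {d/2..t}. u s \<le> 0}"
  have "continuous_on {d/2..t} u"
    using der d(1) by (intro continuous_at_imp_continuous_on ballI) (auto intro!: DERIV_isCont[OF der])
  then have "closed S"
    unfolding S_def by (intro continuous_on_closed_Collect_le) auto
  moreover have "bounded S"
    by (rule bounded_subset[of "{d/2..t}"]) (auto simp: S_def)
  ultimately have "compact S" by (simp add: compact_eq_bounded_closed)
  moreover have "t \<in> S"
    proof -
    have "\<not> t < d" using \<open>\<not> u t > 0\<close> d(2)[of t] \<open>t > 0\<close> by blast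
    then show ?thesis using \<open>\<not> u t > 0\<close> d(1) by (simp add: S_def)
  qed
  ultimately obtain s where s: "s \<in> S" "\<And>r. r \<in> S \<Longrightarrow> s \<le> r"
    using compact_attains_inf[of S] by auto
  have s0: "s > 0" "u s \<le> 0" using s(1) d(1) by (auto simp: S_def)
  have pos: "u r > 0" if "0 < r" "r < s" for r
  proof (cases "r < d")
    case False
    then have "r \<in> {d/2..t}" using s(1) that d(1) by (simp add: S_def)
    moreover have "r \<notin> S" using s(2)[of r] that(2) by fastforce
    ultimately show ?thesis by (simp add: S_def)
  qed (use d that in auto)
  have "isCont u s" by (rule DERIV_isCont[OF der[OF s0(1)]])
  then have "(u \<longlongrightarrow> u s) (at_left s)"
    unfolding isCont_def by (rule filterlim_at_split[THEN iffD1, THEN conjunct1])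
  moreover have "eventually (\<lambda>r. 0 \<le> u r) (at_left s)"
    using eventually_at_left_real[OF s0(1)] by eventually_elim (use pos in force)
  ultimately have "u s \<ge> 0" by (intro tendsto_lowerbound) auto
  then have "u s = 0" using s0 by simp
  then have "u' s > 0" using cross s0 pos by blast
  then obtain e where e: "e > 0" "\<And>h. 0 < h \<Longrightarrow> h < e \<Longrightarrow> u (s - h) < u s"
    using DERIV_pos_inc_left[OF der[OF s0(1)]] by blast
  define h where "h = min (e/2) (s/2)"
  have "0 < h" "h < e" "h < s" using e(1) s0(1) by (auto simp: h_def)
  then have "u (s - h) < 0" "u (s - h) > 0"
    using e(2)[of h] pos[of "s - h"] \<open>u s = 0\<close> by auto
  then show False by simp
qed

lemma abs_exp_minus_linear:
  fixes x :: real
  shows "\<bar>exp x - 1 - x\<bar> \<le> exp \<bar>x\<bar> * x\<^sup>2"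
proof -
  obtain t where t: "\<bar>t\<bar> \<le> \<bar>x\<bar>" "exp x = (\<Sum>m<2. x ^ m / fact m) + exp t / fact 2 * x ^ 2"
    using Maclaurin_exp_le[of x 2] by blast
  have "\<bar>exp x - 1 - x\<bar> = exp t / 2 * x\<^sup>2"
    using t(2) by (simp add: numeral_2_eq_2)
  also have "\<dots> \<le> exp \<bar>x\<bar> * x\<^sup>2"
  proof (rule mult_right_mono)
    have "exp t \<le> exp \<bar>x\<bar>" using t(1) by simp
    moreover have "exp t > 0" by simp
    ultimately show "exp t / 2 \<le> exp \<bar>x\<bar>" by linarith
  qed simp
  finally show ?thesis .
qed

section \<open>Exponentially tilted moments and their derivatives\<close>

text \<open>Left unnormalised, so that a derivative in \<open>t\<close> only raises
  \<open>k\<close>.\<close>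

definition tilted_moment :: "real measure \<Rightarrow> nat \<Rightarrow> real \<Rightarrow> real" where
  "tilted_moment \<alpha> k t = (\<integral>\<sigma>. \<sigma> ^ k * exp (t * \<sigma>) \<partial>\<alpha>)"

locale law_on_unit_interval = prob_space \<alpha> for \<alpha> :: "real measure" +
  assumes sets_law [measurable_cong, simp]: "sets \<alpha> = sets borel"
    and AE_law: "AE \<sigma> in \<alpha>. \<bar>\<sigma>\<bar> \<le> 1"
begin

lemma tilted_moment_bound:
  fixes \<sigma> t :: real
  assumes "\<bar>\<sigma>\<bar> \<le> 1"
  shows "\<bar>\<sigma> ^ k * exp (t * \<sigma>)\<bar> \<le> exp \<bar>t\<bar>"
proof -
  have "\<bar>t * \<sigma>\<bar> \<le> \<bar>t\<bar>"
    using assms by (simp add: abs_mult mult_left_le)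
  then have "exp (t * \<sigma>) \<le> exp \<bar>t\<bar>" by simp
  moreover have "\<bar>\<sigma> ^ k\<bar> \<le> 1" using assms by (simp add: power_abs power_le_one)
  ultimately have "\<bar>\<sigma> ^ k\<bar> * exp (t * \<sigma>) \<le> 1 * exp \<bar>t\<bar>"
    by (intro mult_mono) auto
  then show ?thesis by (simp add: abs_mult)
qed

lemma integrable_tilted_moment: "integrable \<alpha> (\<lambda>\<sigma>. \<sigma> ^ k * exp (t * \<sigma>))"
  using AE_law by (intro integrable_const_bound[of _ "exp \<bar>t\<bar>"])
    (auto simp: tilted_moment_bound elim: eventually_mono)

lemma has_bochner_integral_tilted_moment:
  "has_bochner_integral \<alpha> (\<lambda>\<sigma>. \<sigma> ^ k * exp (t * \<sigma>)) (tilted_moment \<alpha> k t)"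
  unfolding tilted_moment_def by (intro has_bochner_integral_integrable integrable_tilted_moment)

lemma tilted_moment_pos: "tilted_moment \<alpha> 0 t > 0"
proof -
  have "exp (- \<bar>t\<bar>) = (\<integral>\<sigma>. exp (- \<bar>t\<bar>) \<partial>\<alpha>)" by (simp add: prob_space)
  also have "\<dots> \<le> tilted_moment \<alpha> 0 t"
    unfolding tilted_moment_def
  proof (rule integral_mono_AE)
    show "AE \<sigma> in \<alpha>. exp (- \<bar>t\<bar>) \<le> \<sigma> ^ 0 * exp (t * \<sigma>)"
      using AE_law
    proof eventually_elim
      case (elim \<sigma>)
      have "\<bar>t * \<sigma>\<bar> \<le> \<bar>t\<bar>" using elim by (simp add: abs_mult mult_left_le)
      then show ?case by simp
    qed
  qed (use integrable_tilted_moment[of 0 t] in auto)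
  finally show ?thesis using exp_gt_zero less_le_trans by blast
qed

text \<open>Differentiation under the integral by an explicit estimate: as |\<sigma>| \<le> 1 almost
  surely, the error of the difference quotient is at most a constant times |h|, uniformly in
  \<sigma>.\<close>

lemma has_derivative_tilted_moment:
  "(tilted_moment \<alpha> k has_real_derivative tilted_moment \<alpha> (Suc k) t) (at t)"
proof -
  let ?M = "tilted_moment \<alpha>"
  have est: "\<bar>(?M k (t + h) - ?M k t) / h - ?M (Suc k) t\<bar> \<le> exp (\<bar>t\<bar> + 1) * \<bar>h\<bar>"
    if h: "h \<noteq> 0" "\<bar>h\<bar> < 1" for h
  proof -
    have "?M k (t + h) - ?M k t - h * ?M (Suc k) t =
        (\<integral>\<sigma>. \<sigma> ^ k * exp ((t + h) * \<sigma>) - \<sigma> ^ k * exp (t * \<sigma>) - h * (\<sigma> ^ Suc k * exp (t * \<sigma>)) \<partial>\<alpha>)"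
      by (intro has_bochner_integral_integral_eq[symmetric] has_bochner_integral_diff
          has_bochner_integral_mult_right has_bochner_integral_tilted_moment)
    also have "\<bar>\<dots>\<bar> \<le> (\<integral>\<sigma>. exp (\<bar>t\<bar> + 1) * h\<^sup>2 \<partial>\<alpha>)"
    proof (rule integral_abs_bound[THEN order.trans], rule integral_mono_AE)
      show "integrable \<alpha> (\<lambda>\<sigma>. \<bar>\<sigma> ^ k * exp ((t + h) * \<sigma>) - \<sigma> ^ k * exp (t * \<sigma>) - h * (\<sigma> ^ Suc k * exp (t * \<sigma>))\<bar>)"
        using integrable_tilted_moment[of k "t + h"] integrable_tilted_moment[of k t]
        integrable_tilted_moment[of "Suc k" t]
        by (intro integrable_abs Bochner_Integration.integrable_diff integrable_mult_right)
      show "AE \<sigma> in \<alpha>. \<bar>\<sigma> ^ k * exp ((t + h) * \<sigma>) - \<sigma> ^ k * exp (t * \<sigma>) - h * (\<sigma> ^ Suc k * exp (t * \<sigma>))\<bar>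
          \<le> exp (\<bar>t\<bar> + 1) * h\<^sup>2"
        using AE_law
      proof eventually_elim
        case (elim \<sigma>)
        have hs: "\<bar>h * \<sigma>\<bar> \<le> \<bar>h\<bar>" using elim by (simp add: abs_mult mult_left_le)
        have "\<sigma> ^ k * exp ((t + h) * \<sigma>) - \<sigma> ^ k * exp (t * \<sigma>) - h * (\<sigma> ^ Suc k * exp (t * \<sigma>))
           = (\<sigma> ^ k * exp (t * \<sigma>)) * (exp (h * \<sigma>) - 1 - h * \<sigma>)"
          by (simp add: algebra_simps exp_add)
        also have "\<bar>\<dots>\<bar> \<le> exp \<bar>t\<bar> * (exp 1 * h\<^sup>2)"
          unfolding abs_mult[of "\<sigma> ^ k * exp (t * \<sigma>)"]
        proof (rule mult_mono[OF tilted_moment_bound[OF elim]])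
          have "\<bar>exp (h * \<sigma>) - 1 - h * \<sigma>\<bar> \<le> exp \<bar>h * \<sigma>\<bar> * (h * \<sigma>)\<^sup>2" by (rule abs_exp_minus_linear)
          also have "\<dots> \<le> exp 1 * h\<^sup>2"
            using hs h(2) abs_le_square_iff[THEN iffD1, OF hs] by (intro mult_mono) auto
          finally show "\<bar>exp (h * \<sigma>) - 1 - h * \<sigma>\<bar> \<le> exp 1 * h\<^sup>2" .
        qed auto
        finally show ?case by (simp add: exp_add)
      qed
    qed auto
    also have "\<dots> = exp (\<bar>t\<bar> + 1) * h\<^sup>2" by (simp add: prob_space)
    finally have *: "\<bar>?M k (t + h) - ?M k t - h * ?M (Suc k) t\<bar> \<le> exp (\<bar>t\<bar> + 1) * h\<^sup>2" .
    have "\<bar>(?M k (t + h) - ?M k t) / h - ?M (Suc k) t\<bar> = \<bar>?M k (t + h) - ?M k t - h * ?M (Suc k) t\<bar> / \<bar>h\<bar>"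
      using h by (subst abs_divide[symmetric], intro arg_cong[of _ _ abs]) (simp add: field_simps)
    also have "\<dots> \<le> exp (\<bar>t\<bar> + 1) * h\<^sup>2 / \<bar>h\<bar>" by (intro divide_right_mono *) auto
    also have "h\<^sup>2 = \<bar>h\<bar> * \<bar>h\<bar>" by (simp add: power2_eq_square)
    also have "exp (\<bar>t\<bar> + 1) * (\<bar>h\<bar> * \<bar>h\<bar>) / \<bar>h\<bar> = exp (\<bar>t\<bar> + 1) * \<bar>h\<bar>" using h by (simp del: abs_mult_self_eq)
    finally show ?thesis .
  qed
  have "((\<lambda>h. (?M k (t + h) - ?M k t) / h - ?M (Suc k) t) \<longlongrightarrow> 0) (at 0)"
  proof (rule Lim_null_comparison)
    show "eventually (\<lambda>h. norm ((?M k (t + h) - ?M k t) / h - ?M (Suc k) t) \<le> exp (\<bar>t\<bar> + 1) * \<bar>h\<bar>) (at 0)"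
      unfolding eventually_at using est by (intro exI[of _ 1]) auto
    show "((\<lambda>h. exp (\<bar>t\<bar> + 1) * \<bar>h\<bar>) \<longlongrightarrow> 0) (at 0)"
      by (auto intro!: tendsto_eq_intros)
  qed
  then show ?thesis by (simp add: DERIV_def LIM_zero_iff)
qed

end

section \<open>The Beta density and the differential equation of its moment generating
  function\<close>

definition sym_beta_density :: "real \<Rightarrow> real \<Rightarrow> real" where
  "sym_beta_density b \<sigma> = 1 / (2 * Beta b b) * ((1 + \<sigma>) / 2) powr (b - 1) * (1 - (1 + \<sigma>) / 2) powr (b - 1)"

lemma sym_beta_density_measurable [measurable]: "sym_beta_density b \<in> borel_measurable borel"
  unfolding sym_beta_density_def by measurable

lemma Beta_real_pos: "b > 0 \<Longrightarrow> Beta b b > (0::real)"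
  by (simp add: Beta_def Gamma_real_pos)

lemma sym_beta_density_nonneg: "b > 0 \<Longrightarrow> sym_beta_density b \<sigma> \<ge> 0"
  unfolding sym_beta_density_def using Beta_real_pos[of b] by simp

lemma sym_beta_eq: "sym_beta b = density lborel (\<lambda>\<sigma>. ennreal (indicator {-1..1} \<sigma> * sym_beta_density b \<sigma>))"
  unfolding sym_beta_def sym_beta_density_def by simp

lemma has_integral_sym_beta_density:
  assumes "b > 0"
  shows "(sym_beta_density b has_integral 1) {-1..1}"
proof -
  have "((\<lambda>t. t powr (b - 1) * (1 - t) powr (b - 1)) has_integral Beta b b) (cbox 0 1)"
    using has_integral_Beta_real[OF assms assms] by simp
  from has_integral_affinity'[OF this, of "1/2" "1/2"]
  have "((\<lambda>x. ((1 + x) / 2) powr (b - 1) * (1 - (1 + x) / 2) powr (b - 1)) has_integral 2 * Beta b b) {-1..1}"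
    by (simp add: add_divide_distrib add.commute)
  from has_integral_mult_right[OF this, of "1 / (2 * Beta b b)"] show ?thesis
    using Beta_real_pos[OF assms] by (simp add: sym_beta_density_def[abs_def] mult_ac)
qed

lemma law_on_unit_interval_sym_beta:
  assumes "b > 0"
  shows "law_on_unit_interval (sym_beta b)"
proof -
  have "emeasure (sym_beta b) (space (sym_beta b)) =
     (\<integral>\<^sup>+x. ennreal (sym_beta_density b x) * indicator {-1..1} x \<partial>lborel)"
    unfolding sym_beta_eq by (subst emeasure_density) (auto intro!: nn_integral_cong split: split_indicator)
  also have "\<dots> = 1"
    using nn_integral_has_integral_lebesgue'[OF sym_beta_density_nonneg[OF assms] has_integral_sym_beta_density[OF assms]]
    by simp
  finally interpret prob_space "sym_beta b" by (rule prob_spaceI)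
  show ?thesis
  proof unfold_locales
    show "AE \<sigma> in sym_beta b. \<bar>\<sigma>\<bar> \<le> 1"
      unfolding sym_beta_eq by (subst AE_density) (auto intro!: AE_I2 split: split_indicator)
  qed (simp add: sym_beta_eq)
qed

text \<open>A bridge to the gauge integral on the interval, where the fundamental theorem of
  calculus asks for a derivative at interior points only. For b < 1 the density is unbounded near
  the endpoints.\<close>

lemma has_integral_sym_beta:
  assumes "b > 0" and f: "integrable (sym_beta b) f" and [measurable]: "f \<in> borel_measurable borel"
  shows "((\<lambda>\<sigma>. sym_beta_density b \<sigma> * f \<sigma>) has_integral (\<integral>\<sigma>. f \<sigma> \<partial>sym_beta b)) {-1..1}"
proof -
  let ?g = "\<lambda>\<sigma>. (indicator {-1..1} \<sigma> * sym_beta_density b \<sigma>) * f \<sigma>"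
  have "integrable lborel ?g"
    using f unfolding sym_beta_eq
    by (subst (asm) integrable_density) (auto simp: sym_beta_density_nonneg assms(1))
  moreover have "(\<integral>\<sigma>. f \<sigma> \<partial>sym_beta b) = (\<integral>\<sigma>. ?g \<sigma> \<partial>lborel)"
    unfolding sym_beta_eq
    by (subst integral_density) (auto simp: sym_beta_density_nonneg assms(1))
  ultimately have "(?g has_integral (\<integral>\<sigma>. f \<sigma> \<partial>sym_beta b)) UNIV"
    using has_integral_integral_lborel by metis
  also have "?g = (\<lambda>\<sigma>. if \<sigma> \<in> {-1..1} then sym_beta_density b \<sigma> * f \<sigma> else 0)"
    by (auto split: split_indicator)
  finally show ?thesis by (simp only: has_integral_restrict_UNIV)
qed

text \<open>Integrating the derivative of \<open>(1 - \<sigma>\<^sup>2) powr b * exp (t * \<sigma>)\<close>, which vanishes at both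
  endpoints, gives the Bessel-type equation \<open>t M'' + 2 b M' = t M\<close> for the moment generating function \<open>M\<close>.\<close>

lemma tilted_moment_sym_beta_ode:
  assumes b: "b > 0"
  shows "t * tilted_moment (sym_beta b) 2 t + 2 * b * tilted_moment (sym_beta b) 1 t =
         t * tilted_moment (sym_beta b) 0 t"
proof -
  interpret law_on_unit_interval "sym_beta b" by (rule law_on_unit_interval_sym_beta[OF b])
  define B where "B = Beta b b"
  have B_pos: "B > 0" unfolding B_def by (rule Beta_real_pos[OF b])
  define u where "u \<sigma> = (1 + \<sigma>) / 2" for \<sigma> :: real
  \<comment> \<open>As \<open>4 * u \<sigma> * (1 - u \<sigma>) = 1 - \<sigma>\<^sup>2\<close>, this
    is a multiple of the product described above; the factor \<open>2 / B\<close> makes its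
    derivative exactly the density times \<open>p\<close>.\<close>
  define H where "H \<sigma> = 2 / B * (u \<sigma> powr b * (1 - u \<sigma>) powr b * exp (t * \<sigma>))" for \<sigma>
  define p where "p \<sigma> = t * (\<sigma> ^ 0 * exp (t * \<sigma>)) - t * (\<sigma> ^ 2 * exp (t * \<sigma>)) - 2 * b * (\<sigma> ^ 1 * exp (t * \<sigma>))" for \<sigma>
  have deriv: "(H has_real_derivative sym_beta_density b \<sigma> * p \<sigma>) (at \<sigma>)" if "\<sigma> \<in> {-1<..<1}" for \<sigma>
  proof -
    have u01: "u \<sigma> > 0" "1 - u \<sigma> > 0" using that by (auto simp: u_def)
    have eqs: "u \<sigma> powr b = u \<sigma> * u \<sigma> powr (b - 1)"  "(1 - u \<sigma>) powr b = (1 - u \<sigma>) * (1 - u \<sigma>) powr (b - 1)"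
      using u01 by (auto simp: powr_diff)
    have du: "(u has_real_derivative 1/2) (at \<sigma>)" unfolding u_def by (auto intro!: derivative_eq_intros)
    have d1: "((\<lambda>x. u x powr b) has_real_derivative b * u \<sigma> powr (b - 1) * (1/2)) (at \<sigma>)"
      using DERIV_chain2[OF has_real_derivative_powr[OF u01(1)] du] by simp
    have d2: "((\<lambda>x. (1 - u x) powr b) has_real_derivative b * (1 - u \<sigma>) powr (b - 1) * (-1/2)) (at \<sigma>)"
      using DERIV_chain2[OF has_real_derivative_powr[OF u01(2)] DERIV_diff[OF DERIV_const[of 1] du]] by simp
    have d3: "((\<lambda>x. exp (t * x)) has_real_derivative t * exp (t * \<sigma>)) (at \<sigma>)"
      by (auto intro!: derivative_eq_intros)
    have "(H has_real_derivative 2 / B * ((b * u \<sigma> powr (b - 1) * (1/2) * (1 - u \<sigma>) powr b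
        + u \<sigma> powr b * (b * (1 - u \<sigma>) powr (b - 1) * (- 1/2))) * exp (t * \<sigma>)
        + u \<sigma> powr b * (1 - u \<sigma>) powr b * (t * exp (t * \<sigma>)))) (at \<sigma>)"
      unfolding H_def
      by (rule DERIV_cmult[THEN DERIV_cong], rule DERIV_mult[OF DERIV_mult[OF d1 d2] d3]) (simp add: algebra_simps)
    also have "2 / B * ((b * u \<sigma> powr (b - 1) * (1/2) * (1 - u \<sigma>) powr b
        + u \<sigma> powr b * (b * (1 - u \<sigma>) powr (b - 1) * (- 1/2))) * exp (t * \<sigma>)
        + u \<sigma> powr b * (1 - u \<sigma>) powr b * (t * exp (t * \<sigma>)))
       = 1 / (2 * B) * u \<sigma> powr (b - 1) * (1 - u \<sigma>) powr (b - 1) * exp (t * \<sigma>) *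
          (2 * b * (1 - 2 * u \<sigma>) + t * (4 * u \<sigma> * (1 - u \<sigma>)))"
      unfolding eqs using B_pos by (simp add: field_simps)
    also have "\<dots> = sym_beta_density b \<sigma> * p \<sigma>"
    proof -
      have "2 * b * (1 - 2 * u \<sigma>) + t * (4 * u \<sigma> * (1 - u \<sigma>)) = t - t * \<sigma>\<^sup>2 - 2 * b * \<sigma>"
        by (simp add: u_def power2_eq_square field_simps)
      moreover have "p \<sigma> = exp (t * \<sigma>) * (t - t * \<sigma>\<^sup>2 - 2 * b * \<sigma>)"
        by (simp add: p_def algebra_simps)
      ultimately show ?thesis
        by (simp only: sym_beta_density_def u_def[symmetric] B_def[symmetric] mult.assoc)
    qed
    finally show ?thesis .
  qed
  \<comment> \<open>Here b > 0 enters: \<open>H\<close> extends continuously by 0 to the endpoints,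
    even where the density blows up.\<close>
  have "continuous_on {-1..1} H"
    unfolding H_def u_def using b by (intro continuous_intros continuous_on_powr') auto
  then have "((\<lambda>\<sigma>. sym_beta_density b \<sigma> * p \<sigma>) has_integral (H 1 - H (-1))) {-1..1}"
    using deriv by (intro fundamental_theorem_of_calculus_interior)
       (auto simp: has_real_derivative_iff_has_vector_derivative)
  moreover have "H 1 - H (-1) = 0" using b by (simp add: H_def u_def)
  moreover have p: "has_bochner_integral (sym_beta b) p (t * tilted_moment (sym_beta b) 0 t
      - t * tilted_moment (sym_beta b) 2 t - 2 * b * tilted_moment (sym_beta b) 1 t)"
    unfolding p_def by (intro has_bochner_integral_diff has_bochner_integral_mult_right has_bochner_integral_tilted_moment)
  have "((\<lambda>\<sigma>. sym_beta_density b \<sigma> * p \<sigma>) has_integral (\<integral>\<sigma>. p \<sigma> \<partial>sym_beta b)) {-1..1}"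
    using p by (intro has_integral_sym_beta[OF b]) (simp_all only: has_bochner_integral_iff, simp add: p_def[abs_def])
  ultimately have "(\<integral>\<sigma>. p \<sigma> \<partial>sym_beta b) = 0" using has_integral_unique by metis
  then show ?thesis using p by (simp add: has_bochner_integral_iff del: One_nat_def)
qed

lemma deriv_eqI: "(\<And>t. (F has_field_derivative G t) (at t)) \<Longrightarrow> deriv F = G"
  by (auto intro!: ext DERIV_imp_deriv)

section \<open>Cumulants of the tilted Beta law and the Riccati equation\<close>

locale sym_beta_law =
  fixes b :: real
  assumes b_pos: "b > 0"
begin

sublocale law_on_unit_interval "sym_beta b"
  by (rule law_on_unit_interval_sym_beta[OF b_pos])

abbreviation mom :: "nat \<Rightarrow> real \<Rightarrow> real" where
  "mom \<equiv> tilted_moment (sym_beta b)"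

text \<open>The moments of the law tilted by \<open>exp (t * \<sigma>)\<close>. The polynomials
  \<open>f\<close>, \<open>f1\<close>, \<open>f2\<close>, \<open>f3\<close> in them are its first
  four cumulants, that is, the successive derivatives of \<open>log_mgf\<close>.\<close>

definition mean :: "nat \<Rightarrow> real \<Rightarrow> real" where
  "mean k t = mom k t / mom 0 t"

definition f :: "real \<Rightarrow> real" where "f = mean 1"
definition f1 :: "real \<Rightarrow> real" where "f1 t = mean 2 t - (mean 1 t)\<^sup>2"
definition f2 :: "real \<Rightarrow> real" where
  "f2 t = mean 3 t - 3 * mean 1 t * mean 2 t + 2 * (mean 1 t) ^ 3"
definition f3 :: "real \<Rightarrow> real" where
  "f3 t = mean 4 t - 4 * mean 1 t * mean 3 t - 3 * (mean 2 t)\<^sup>2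
     + 12 * (mean 1 t)\<^sup>2 * mean 2 t - 6 * (mean 1 t) ^ 4"

text \<open>The variance of \<open>sym_beta b\<close>, and thereby the slope of \<open>f\<close> at
  0.\<close>

definition \<kappa> :: real where "\<kappa> = 1 / (2 * b + 1)"

lemma mom_0_0: "mom 0 0 = 1"
  by (simp add: tilted_moment_def prob_space)

lemma DERIV_mean: "(mean k has_real_derivative mean (Suc k) t - mean k t * mean 1 t) (at t)"
proof -
  have "mom 0 t \<noteq> 0" using tilted_moment_pos[of t] by simp
  then show ?thesis unfolding mean_def
    by (auto intro!: derivative_eq_intros has_derivative_tilted_moment simp: field_simps)
qed

lemma DERIV_mean_numeral:
  "(mean 1 has_real_derivative mean 2 t - mean 1 t * mean 1 t) (at t)"
  "(mean 2 has_real_derivative mean 3 t - mean 2 t * mean 1 t) (at t)"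
  "(mean 3 has_real_derivative mean 4 t - mean 3 t * mean 1 t) (at t)"
  using DERIV_mean[of 1 t] DERIV_mean[of 2 t] DERIV_mean[of 3 t]
  by (simp_all add: eval_nat_numeral)

lemma DERIV_log_mgf: "(log_mgf (sym_beta b) has_real_derivative f t) (at t)"
proof -
  have "log_mgf (sym_beta b) = (\<lambda>t. ln (mom 0 t))"
    by (simp add: log_mgf_def[abs_def] tilted_moment_def)
  then show ?thesis using tilted_moment_pos[of t]
    by (auto intro!: derivative_eq_intros has_derivative_tilted_moment simp: f_def mean_def field_simps)
qed

lemma DERIV_f: "(f has_real_derivative f1 t) (at t)"
  unfolding f_def f1_def using DERIV_mean_numeral(1)[of t] by (simp add: power2_eq_square)

lemma DERIV_f1: "(f1 has_real_derivative f2 t) (at t)"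
  unfolding f1_def[abs_def] f2_def
  by (rule derivative_eq_intros DERIV_mean_numeral refl)+ (simp add: algebra_simps eval_nat_numeral)

lemma DERIV_f2: "(f2 has_real_derivative f3 t) (at t)"
  unfolding f2_def[abs_def] f3_def
  by (rule derivative_eq_intros DERIV_mean_numeral refl)+ (simp add: algebra_simps eval_nat_numeral)

text \<open>The differential equation differentiated \<open>k\<close> times. At t = 0 it is a
  recursion for the plain moments. For \<open>k = 0\<close> the truncated index \<open>k - 1\<close>
  is harmless, its coefficient being 0.\<close>

lemma mom_recurrence:
  "t * mom (k + 2) t + (2 * b + k) * mom (k + 1) t = t * mom k t + k * mom (k - 1) t"
proof (induction k arbitrary: t)
  case 0
  then show ?case using tilted_moment_sym_beta_ode[OF b_pos, of t] by (simp add: numeral_2_eq_2)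
next
  case (Suc k)
  have "((\<lambda>t. t * mom (k + 2) t + (2 * b + k) * mom (k + 1) t) has_real_derivative
      mom (k + 2) t + t * mom (k + 3) t + (2 * b + k) * mom (k + 2) t) (at t)"
    by (rule derivative_eq_intros has_derivative_tilted_moment refl)+ (simp add: algebra_simps eval_nat_numeral)
  moreover have "((\<lambda>t. t * mom k t + k * mom (k - 1) t) has_real_derivative
      mom k t + t * mom (k + 1) t + k * mom k t) (at t)"
    by (cases k) (auto intro!: derivative_eq_intros has_derivative_tilted_moment)
  ultimately have "mom (k + 2) t + t * mom (k + 3) t + (2 * b + k) * mom (k + 2) t =
      mom k t + t * mom (k + 1) t + k * mom k t"
    unfolding Suc.IH by (rule DERIV_unique)
  then show ?case by (simp add: algebra_simps eval_nat_numeral)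
qed

lemma mean_0:
  "mean 1 0 = 0" "mean 2 0 = \<kappa>" "mean 3 0 = 0" "mean 4 0 = 3 * \<kappa> / (2 * b + 3)"
proof -
  have "mom 1 0 = 0" "(1 + 2 * b) * mom 2 0 = 1" "(2 + 2 * b) * mom 3 0 = 0" "(3 + 2 * b) * mom 4 0 = 3 * mom 2 0"
    using mom_recurrence[of 0 0] mom_recurrence[of 0 1] mom_recurrence[of 0 2] mom_recurrence[of 0 3] b_pos mom_0_0
    by (simp_all add: eval_nat_numeral algebra_simps)
  moreover have "1 + 2 * b \<noteq> 0" "2 + 2 * b \<noteq> 0" "3 + 2 * b \<noteq> 0" using b_pos by auto
  ultimately have "mom 1 0 = 0" "mom 2 0 = \<kappa>" "mom 3 0 = 0" "mom 4 0 = 3 * mom 2 0 / (2 * b + 3)"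
    unfolding \<kappa>_def by (auto simp: nonzero_eq_divide_eq mult.commute add.commute)
  then show "mean 1 0 = 0" "mean 2 0 = \<kappa>" "mean 3 0 = 0" "mean 4 0 = 3 * \<kappa> / (2 * b + 3)"
    by (simp_all add: mean_def mom_0_0)
qed

lemma f_0: "f 0 = 0" and f1_0: "f1 0 = \<kappa>" and f2_0: "f2 0 = 0"
  by (simp_all add: f_def f1_def f2_def mean_0 del: One_nat_def)

text \<open>With vanishing odd moments the fourth cumulant is the fourth moment minus three times
  the squared variance, and the recursion makes it a positive multiple of 1/(2b+3) -
  1/(2b+1).\<close>

lemma f3_0: "f3 0 < 0"
proof -
  have "f3 0 = 3 * \<kappa> * (1 / (2 * b + 3) - 1 / (2 * b + 1))"
    by (simp add: f3_def mean_0 del: One_nat_def) (simp add: \<kappa>_def power2_eq_square algebra_simps)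
  moreover have "1 / (2 * b + 3) < 1 / (2 * b + 1)" "\<kappa> > 0"
    using b_pos by (auto simp: \<kappa>_def field_simps)
  ultimately show ?thesis by (simp add: mult_less_0_iff)
qed

text \<open>The linear second order equation divided by \<open>mom 0 t\<close>. Keeping the factor
  \<open>t\<close> makes it an identity on the whole line, so it can be differentiated twice without
  treating t = 0 separately.\<close>

lemma riccati: "t * f1 t + t * (f t)\<^sup>2 + 2 * b * f t = t"
proof -
  have "mom 0 t \<noteq> 0" using tilted_moment_pos[of t] by simp
  then show ?thesis
    using tilted_moment_sym_beta_ode[OF b_pos, of t]
    by (simp add: f_def f1_def mean_def field_simps)
qed

lemma riccati': "(1 + 2 * b) * f1 t + t * f2 t + (f t)\<^sup>2 + 2 * t * f t * f1 t = 1"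
proof -
  have "((\<lambda>t. t * f1 t + t * (f t)\<^sup>2 + 2 * b * f t) has_real_derivative
      (1 + 2 * b) * f1 t + t * f2 t + (f t)\<^sup>2 + 2 * t * f t * f1 t) (at t)"
    by (rule derivative_eq_intros DERIV_f DERIV_f1 refl)+ (simp add: algebra_simps power2_eq_square)
  then show ?thesis unfolding riccati using DERIV_ident DERIV_unique by blast
qed

lemma riccati'': "(2 + 2 * b) * f2 t + t * f3 t + 4 * f t * f1 t + 2 * t * ((f1 t)\<^sup>2 + f t * f2 t) = 0"
proof -
  have "((\<lambda>t. (1 + 2 * b) * f1 t + t * f2 t + (f t)\<^sup>2 + 2 * t * f t * f1 t) has_real_derivative
      (2 + 2 * b) * f2 t + t * f3 t + 4 * f t * f1 t + 2 * t * ((f1 t)\<^sup>2 + f t * f2 t)) (at t)"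
    by (rule derivative_eq_intros DERIV_f DERIV_f1 DERIV_f2 refl)+ (simp add: algebra_simps power2_eq_square)
  then show ?thesis unfolding riccati' using DERIV_const DERIV_unique by blast
qed

lemma continuous_on_f: "continuous_on A f"
  and continuous_on_f1: "continuous_on A f1"
  by (auto intro!: continuous_at_imp_continuous_on DERIV_isCont[OF DERIV_f] DERIV_isCont[OF DERIV_f1])

lemma \<kappa>_pos: "\<kappa> > 0" and \<kappa>_less_1: "\<kappa> < 1"
  using b_pos by (auto simp: \<kappa>_def)

section \<open>Monotonicity and concavity of the tilted mean\<close>

text \<open>At a first zero t of \<open>f1\<close> the function \<open>f\<close> has increased from
  0, so f(t) > 0. There \<open>riccati\<close> reads 2 b f = t (1 - f^2), which makes 1 - f^2
  positive, and \<open>riccati'\<close> identifies 1 - f^2 with t f''.\<close>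

lemma f1_pos: 
  assumes "t \<ge> 0"
  shows "f1 t > 0"
proof (cases "t = 0")
  case False
  show ?thesis
  proof (rule positive_if_positive_crossings[where u' = f2, OF DERIV_f1])
    have "(f1 \<longlongrightarrow> \<kappa>) (at_right 0)"
      using continuous_on_f1[of UNIV] unfolding f1_0[symmetric]
      by (auto simp: continuous_on_def intro: filterlim_mono[OF _ order_refl at_le])
    then show "eventually (\<lambda>t. f1 t > 0) (at_right 0)" using \<kappa>_pos order_tendstoD(1) by blast
  next
    fix t :: real assume t: "t > 0" "f1 t = 0" "\<And>s. 0 < s \<Longrightarrow> s < t \<Longrightarrow> f1 s > 0"
    have "f 0 < f t"
      by (rule DERIV_pos_imp_increasing_open[OF t(1)]) (use t(3) DERIV_f continuous_on_f in blast)+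
    then have "0 < t * (2 * b * f t)" using b_pos t(1) f_0 by simp
    also have "2 * b * f t = t * (1 - (f t)\<^sup>2)" using riccati[of t] t(2) by (simp add: algebra_simps)
    also have "1 - (f t)\<^sup>2 = t * f2 t" using riccati'[of t] t(2) by (simp add: algebra_simps)
    finally show "f2 t > 0" using t(1) by (simp add: zero_less_mult_iff)
  qed (use assms False in auto)
qed (use f1_0 \<kappa>_pos in simp)

lemma f_pos: "t > 0 \<Longrightarrow> f t > 0"
proof -
  assume "t > 0"
  have "f 0 < f t"
    by (rule DERIV_pos_imp_increasing_open[OF \<open>t > 0\<close>]) (use f1_pos DERIV_f continuous_on_f less_imp_le in blast)+
  then show ?thesis using f_0 by simp
qed

text \<open>Where \<open>f2\<close> vanishes, \<open>riccati''\<close> leaves t f''' = -(4 f f' + 2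
  t f'^2) < 0, so \<open>- f2\<close> can reach 0 only with a positive derivative. The sign near 0
  is supplied by \<open>f3_0\<close>.\<close>

lemma f2_neg: 
  assumes "t > 0"
  shows "f2 t < 0"
proof -
  have "- f2 t > 0"
  proof (rule positive_if_positive_crossings[where u = "\<lambda>t. - f2 t" and u' = "\<lambda>t. - f3 t"])
    fix t :: real assume t: "t > 0" "- f2 t = 0"
    have "t * f3 t = - (4 * f t * f1 t + 2 * t * (f1 t)\<^sup>2)"
      using riccati''[of t] t(2) by (simp add: algebra_simps)
    moreover have "4 * f t * f1 t + 2 * t * (f1 t)\<^sup>2 > 0"
      using t(1) f_pos[of t] f1_pos[of t] by (intro add_pos_pos mult_pos_pos) auto
    ultimately show "- f3 t > 0" using t(1) by (smt (verit) mult_nonneg_nonneg)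
  next
    obtain d where "d > 0" "\<And>h. 0 < h \<Longrightarrow> h < d \<Longrightarrow> f2 (0 + h) < f2 0"
      using DERIV_neg_dec_right[OF DERIV_f2[of 0] f3_0] by auto
    then show "eventually (\<lambda>t. - f2 t > 0) (at_right 0)"
      unfolding eventually_at_right_field f2_0 by (intro exI[of _ d]) auto
  qed (use assms in \<open>auto intro!: derivative_intros DERIV_f2\<close>)
  then show ?thesis by simp
qed

text \<open>The difference f - t f' vanishes at 0 and has derivative -t f'' > 0. Up to sign it is
  the numerator in the derivative of f(t) / t.\<close>

lemma times_f1_less_f:
  assumes "t > 0"
  shows "t * f1 t < f t"
proof -
  have "(\<lambda>t. f t - t * f1 t) 0 < (\<lambda>t. f t - t * f1 t) t"
  proof (rule DERIV_pos_imp_increasing_open[OF assms])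
    show "\<exists>y. ((\<lambda>t. f t - t * f1 t) has_real_derivative y) (at x) \<and> 0 < y" if "0 < x" for x
    proof (intro exI conjI)
      show "((\<lambda>t. f t - t * f1 t) has_real_derivative (- x * f2 x)) (at x)"
        by (rule derivative_eq_intros DERIV_f DERIV_f1 refl)+ simp
      show "0 < - x * f2 x" using that f2_neg[OF that] by (simp add: mult_less_0_iff)
    qed
    show "continuous_on {0..t} (\<lambda>t. f t - t * f1 t)"
      by (intro continuous_intros continuous_on_f continuous_on_f1)
  qed
  then show ?thesis using f_0 by simp
qed

lemma f_ratio_decreasing:
  assumes "0 < x" "x < y"
  shows "f y / y < f x / x"
proof (rule DERIV_neg_imp_decreasing[OF assms(2)])
  fix t assume "x \<le> t" "t \<le> y"
  then have t: "t > 0" using assms by simp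
  have "((\<lambda>t. f t / t) has_real_derivative (t * f1 t - f t) / (t * t)) (at t)"
    by (rule derivative_eq_intros DERIV_f refl)+ (use t in \<open>auto simp: algebra_simps\<close>)
  moreover have "(t * f1 t - f t) / (t * t) < 0"
    using times_f1_less_f[OF t] t by (simp add: divide_neg_pos)
  ultimately show "\<exists>y. ((\<lambda>t. f t / t) has_real_derivative y) (at t) \<and> y < 0" by blast
qed

text \<open>Read off from the Riccati equation: t (1 - f^2) = t f' + 2 b f is positive.\<close>

lemma f_le_1:
  assumes "t \<ge> 0"
  shows "f t \<le> 1"
proof (cases "t = 0")
  case False
  then have t: "t > 0" using assms by simp
  have "t * (1 - (f t)\<^sup>2) = t * f1 t + 2 * b * f t"
    using riccati[of t] by (simp add: algebra_simps)
  also have "\<dots> > 0" using t b_pos f1_pos[of t] f_pos[of t] by (intro add_pos_pos mult_pos_pos) auto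
  finally have "(f t)\<^sup>2 < 1" using t by (simp add: zero_less_mult_iff)
  then show ?thesis by (simp add: power_less_one_iff abs_square_less_1)
qed (simp add: f_0)

lemma f_nonneg: "t \<ge> 0 \<Longrightarrow> f t \<ge> 0"
  using f_pos[of t] f_0 by (cases "t = 0") auto

lemma f_le_linear:
  assumes "t \<ge> 0"
  shows "f t \<le> \<kappa> * t"
proof (cases "t = 0")
  case False
  then have t: "t > 0" using assms by simp
  have "f1 s < \<kappa>" if "s > 0" for s
    unfolding f1_0[symmetric]
    by (rule DERIV_neg_imp_decreasing_open[OF that]) (use f2_neg DERIV_f1 continuous_on_f1 in blast)+
  then have "(\<lambda>t. \<kappa> * t - f t) 0 < (\<lambda>t. \<kappa> * t - f t) t"
    by (intro DERIV_pos_imp_increasing_open[OF t])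
       (auto intro!: derivative_eq_intros DERIV_f continuous_intros continuous_on_f exI[of _ "\<kappa> - f1 x" for x])
  then show ?thesis by (simp add: f_0)
qed (simp add: f_0)

section \<open>Two-sided cubic bounds for the defect\<close>

text \<open>The linear bound is f \<ge> 0. For the cubic one, t f' \<le> f turns the Riccati
  equation into t - (2b+1) f \<le> t f^2, where f \<le> \<kappa> t \<le> t; multiplication by
  \<kappa> = 1/(2b+1) finishes.\<close>

lemma defect_upper:
  assumes "t \<ge> 0"
  shows "\<kappa> * t - f t \<le> \<kappa> * min t (t ^ 3)"
proof -
  have "\<kappa> * t - f t \<le> \<kappa> * t" using f_nonneg[OF assms] by simp
  moreover have "\<kappa> * t - f t \<le> \<kappa> * t ^ 3"
  proof -
    have "t - (2 * b + 1) * f t \<le> t * (f t)\<^sup>2"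
      using riccati[of t] times_f1_less_f[of t] assms f_0 by (cases "t = 0") (auto simp: algebra_simps)
    also have "\<dots> \<le> t * (1 * t)\<^sup>2"
    proof (intro mult_left_mono power_mono)
      show "f t \<le> 1 * t"
        using f_le_linear[OF assms] \<kappa>_less_1 assms
        by (meson less_imp_le mult_right_mono order_trans)
    qed (use assms f_nonneg in auto)
    finally have "\<kappa> * (t - (2 * b + 1) * f t) \<le> \<kappa> * t ^ 3"
      using \<kappa>_pos by (intro mult_left_mono) (auto simp: eval_nat_numeral)
    moreover have "\<kappa> * (2 * b + 1) = 1" using b_pos by (simp add: \<kappa>_def)
    ultimately show ?thesis by (simp add: right_diff_distrib flip: mult.assoc)
  qed
  ultimately show ?thesis by (simp add: min_def)
qed

text \<open>On [0, 1] concavity gives f(x) \<ge> f(1) x. Integrating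
  \<open>(f 1)\<^sup>2 * x powr (2 * b + 2)\<close> from 0 produces the denominator 2b + 3.\<close>

definition defect_const :: real where "defect_const = (f 1)\<^sup>2 / (2 * b + 3)"

lemma defect_const_pos: "defect_const > 0"
  using f_pos[of 1] b_pos by (simp add: defect_const_def)

text \<open>The Riccati equation says that \<open>t powr (2 * b) * (\<kappa> * t - f t)\<close> has derivative
  \<open>t powr (2 * b) * (f t)\<^sup>2\<close>, which is bounded below by concavity of \<open>f\<close>.\<close>

lemma defect_lower_near_0:
  assumes "0 \<le> t" "t \<le> 1"
  shows "defect_const * t ^ 3 \<le> \<kappa> * t - f t"
proof (cases "t = 0")
  case False
  then have t: "t > 0" using assms by simp
  let ?c = defect_const
  let ?P = "\<lambda>t. t powr (2 * b) * (\<kappa> * t - f t - ?c * t ^ 3)"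
  have "?P 0 \<le> ?P t"
  proof (rule DERIV_nonneg_imp_increasing_open[OF assms(1)])
    show "continuous_on {0..t} ?P"
      using b_pos by (intro continuous_intros continuous_on_f continuous_on_powr') auto
    fix x assume x: "0 < x" "x < t"
    have "\<kappa> * (2 * b + 1) = 1" using b_pos by (simp add: \<kappa>_def)
    then have k: "2 * b * \<kappa> + \<kappa> = 1" by (simp add: algebra_simps)
    have D: "((\<lambda>t. \<kappa> * t - f t - ?c * t ^ 3) has_real_derivative \<kappa> - f1 x - ?c * (3 * x\<^sup>2)) (at x)"
      by (rule derivative_eq_intros DERIV_f refl)+ simp
    have "(?P has_real_derivative
        2 * b * x powr (2 * b - 1) * (\<kappa> * x - f x - ?c * x ^ 3) + x powr (2 * b) * (\<kappa> - f1 x - ?c * (3 * x\<^sup>2))) (at x)"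
      using DERIV_mult[OF has_real_derivative_powr[OF x(1), of "2 * b"] D] by (simp add: algebra_simps)
    also have "x powr (2 * b) = x powr (2 * b - 1) * x" using x(1) by (simp add: powr_diff)
    also have "2 * b * x powr (2 * b - 1) * (\<kappa> * x - f x - ?c * x ^ 3) + x powr (2 * b - 1) * x * (\<kappa> - f1 x - ?c * (3 * x\<^sup>2))
       = x powr (2 * b - 1) * ((2 * b * \<kappa> + \<kappa>) * x - 2 * b * f x - x * f1 x - ?c * (2 * b + 3) * x ^ 3)"
      by (simp add: algebra_simps eval_nat_numeral)
    also have "(2 * b * \<kappa> + \<kappa>) * x - 2 * b * f x - x * f1 x = x * (f x)\<^sup>2"
      unfolding k using riccati[of x] by simp
    also have "?c * (2 * b + 3) * x ^ 3 = x * (f 1 * x)\<^sup>2"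
      using b_pos by (simp add: defect_const_def power_mult_distrib eval_nat_numeral)
    finally have "(?P has_real_derivative x powr (2 * b - 1) * (x * (f x)\<^sup>2 - x * (f 1 * x)\<^sup>2)) (at x)" .
    moreover have "f 1 * x \<le> f x"
      using f_ratio_decreasing[of x 1] x assms by (simp add: field_simps)
    then have "(f 1 * x)\<^sup>2 \<le> (f x)\<^sup>2" using x f_pos[of 1] by (intro power_mono) auto
    then have "0 \<le> x powr (2 * b - 1) * (x * (f x)\<^sup>2 - x * (f 1 * x)\<^sup>2)"
      using x by (intro mult_nonneg_nonneg) auto
    ultimately show "\<exists>y. (?P has_real_derivative y) (at x) \<and> 0 \<le> y" by blast
  qed
  then show ?thesis using t f_0 by (simp add: zero_le_mult_iff)
qed (simp add: f_0)

text \<open>Beyond 1 the ratio f(t) / t stays below f(1), so the defect is at least its value at 1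
  times t, and the bound near 0 applies at the endpoint 1.\<close>

lemma defect_lower:
  assumes "t \<ge> 0"
  shows "defect_const * min t (t ^ 3) \<le> \<kappa> * t - f t"
proof (cases "t \<le> 1")
  case True
  then have "t ^ 3 \<le> t" using assms power_decreasing[of 1 3 t] by simp
  then have "min t (t ^ 3) = t ^ 3" by simp
  then show ?thesis using defect_lower_near_0[OF assms True] by simp
next
  case False
  then have "f t / t \<le> f 1" using f_ratio_decreasing[of 1 t] by simp
  then have "f t \<le> f 1 * t" using False by (simp add: field_simps)
  moreover have "defect_const * t \<le> (\<kappa> - f 1) * t"
    using defect_lower_near_0[of 1] False by (intro mult_right_mono) auto
  moreover have "min t (t ^ 3) = t" using False power_increasing[of 1 3 t] by simp
  ultimately show ?thesis by (simp add: algebra_simps)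
qed

end

section \<open>The mean-field equation\<close>

text \<open>Collects what the fixed point analysis uses of the tilted mean: bounds, decreasing ratio
  and two-sided defect. The Beta law is absent from this part and returns only as an
  instance.\<close>

locale mean_field = prob_space M for M :: "'w measure" +
  fixes W :: "'w \<Rightarrow> real" and f :: "real \<Rightarrow> real" and \<kappa> c C :: real
  assumes W_measurable [measurable]: "W \<in> borel_measurable M"
    and W_pos: "\<omega> \<in> space M \<Longrightarrow> 0 < W \<omega>"
    and integrable_W2: "integrable M (\<lambda>\<omega>. W \<omega> ^ 2)"
    and f_cont: "continuous_on UNIV f"
    and f_pos: "0 < x \<Longrightarrow> 0 < f x"
    and f_le_1: "0 \<le> x \<Longrightarrow> f x \<le> 1"
    and f_ratio: "0 < x \<Longrightarrow> x < y \<Longrightarrow> f y / y < f x / x"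
    and kappa_pos: "0 < \<kappa>"
    and c_pos: "0 < c"
    and f_lower: "0 \<le> x \<Longrightarrow> c * min x (x ^ 3) \<le> \<kappa> * x - f x"
    and f_upper: "0 \<le> x \<Longrightarrow> \<kappa> * x - f x \<le> C * min x (x ^ 3)"
begin

lemma f_0: "f 0 = 0"
  using f_lower[of 0] f_upper[of 0] by simp

lemma f_nonneg: "0 \<le> x \<Longrightarrow> 0 \<le> f x"
  using f_pos[of x] f_0 by (cases "x = 0") auto

lemma C_pos: "0 < C"
  using f_lower[of 1] f_upper[of 1] c_pos by simp

lemma f_measurable [measurable]: "f \<in> borel_measurable borel"
  using f_cont by (rule borel_measurable_continuous_onI)

lemma integrable_W: "integrable M W"
proof (rule Bochner_Integration.integrable_bound)
  show "integrable M (\<lambda>\<omega>. 1 + W \<omega> ^ 2)" using integrable_W2 by simp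
  have "\<bar>x\<bar> \<le> 1 + x\<^sup>2" for x :: real
    using zero_le_power2[of "\<bar>x\<bar> - 1"] by (simp add: power2_eq_square algebra_simps)
  then show "AE \<omega> in M. norm (W \<omega>) \<le> norm (1 + W \<omega> ^ 2)" by simp
qed simp

lemma integral_pos:
  fixes g :: "'w \<Rightarrow> real"
  assumes "integrable M g" "\<And>\<omega>. \<omega> \<in> space M \<Longrightarrow> 0 < g \<omega>"
  shows "0 < (\<integral>\<omega>. g \<omega> \<partial>M)"
proof -
  have "(\<integral>\<omega>. 0 \<partial>M) < (\<integral>\<omega>. g \<omega> \<partial>M)"
    by (rule integral_less_AE_space) (use assms in \<open>auto simp: emeasure_space_1\<close>)
  then show ?thesis by simp
qed

definition \<mu> :: real where "\<mu> = (\<integral>\<omega>. W \<omega> \<partial>M)"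
definition \<theta>c :: real where "\<theta>c = \<mu> / ((\<integral>\<omega>. W \<omega> ^ 2 \<partial>M) * \<kappa>)"
definition \<Phi> :: "real \<Rightarrow> real \<Rightarrow> real" where "\<Phi> h m = (\<integral>\<omega>. W \<omega> * f (W \<omega> * m + h) \<partial>M) / \<mu>"
text \<open>The profile of the defect. \<open>K\<close> averages it in the size-biased law, up to
  the factor \<mu>, and \<open>L m\<close> is \<open>K 0 m\<close> with one factor \<open>m\<close>
  taken out, so that no division by \<open>m\<close> occurs.\<close>

definition cut :: "real \<Rightarrow> real" where "cut x = min x (x ^ 3)"
definition K :: "real \<Rightarrow> real \<Rightarrow> real" where "K h m = (\<integral>\<omega>. W \<omega> * cut (W \<omega> * m + h) \<partial>M)"
definition L :: "real \<Rightarrow> real" where "L m = (\<integral>\<omega>. W \<omega> ^ 2 * min 1 ((W \<omega> * m)\<^sup>2) \<partial>M)"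

lemma cut_measurable [measurable]: "cut \<in> borel_measurable borel"
  unfolding cut_def by measurable

lemma cut_nonneg: "0 \<le> x \<Longrightarrow> 0 \<le> cut x" and cut_le: "cut x \<le> x"
  and cut_le': "cut x \<le> x ^ 3"
  by (auto simp: cut_def)

lemma cut_mono: "0 \<le> x \<Longrightarrow> x \<le> y \<Longrightarrow> cut x \<le> cut y"
  unfolding cut_def by (intro min.mono power_mono) auto

lemma cut_add: 
  assumes "0 \<le> x" "0 \<le> y"
  shows "cut (x + y) \<le> 8 * (cut x + cut y)"
proof -
  \<comment> \<open>The factor 8 = 2^3 is the worst growth of \<open>cut\<close> when its argument
    doubles.\<close>
  let ?z = "max x y"
  have "cut (x + y) \<le> cut (2 * ?z)" using assms by (intro cut_mono) auto
  also have "\<dots> \<le> 8 * cut ?z" using assms by (auto simp: cut_def power_mult_distrib min_def)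
  also have "cut ?z \<le> cut x + cut y" using assms cut_nonneg[of x] cut_nonneg[of y] by (auto simp: max_def)
  finally show ?thesis by simp
qed

lemma mu_pos: "0 < \<mu>"
  unfolding \<mu>_def using integrable_W W_pos by (rule integral_pos)

lemma W2_pos: "0 < (\<integral>\<omega>. W \<omega> ^ 2 \<partial>M)"
  using W_pos by (intro integral_pos integrable_W2) force

lemma theta_c_pos: "0 < \<theta>c"
  unfolding \<theta>c_def using mu_pos W2_pos kappa_pos by simp

lemma arg_nonneg: "\<omega> \<in> space M \<Longrightarrow> 0 \<le> m \<Longrightarrow> 0 \<le> h \<Longrightarrow> 0 \<le> W \<omega> * m + h"
  using W_pos[of \<omega>] by simp

lemma integrable_W_f:
  assumes "0 \<le> h" "0 \<le> m"
  shows "integrable M (\<lambda>\<omega>. W \<omega> * f (W \<omega> * m + h))"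
proof (rule Bochner_Integration.integrable_bound[OF integrable_W])
  show "AE \<omega> in M. norm (W \<omega> * f (W \<omega> * m + h)) \<le> norm (W \<omega>)"
  proof (rule AE_I2)
    fix \<omega> assume w: "\<omega> \<in> space M"
    have "0 \<le> f (W \<omega> * m + h)" "f (W \<omega> * m + h) \<le> 1"
      using f_nonneg f_le_1 arg_nonneg[OF w assms(2,1)] by auto
    then show "norm (W \<omega> * f (W \<omega> * m + h)) \<le> norm (W \<omega>)"
      using W_pos[OF w] by (simp add: abs_mult)
  qed
qed measurable

lemma integrable_linear: "integrable M (\<lambda>\<omega>. W \<omega> * (W \<omega> * m + h))"
  using integrable_W integrable_W2 by (simp add: algebra_simps power2_eq_square)

lemma integral_linear: "(\<integral>\<omega>. W \<omega> * (W \<omega> * m + h) \<partial>M) = m * (\<integral>\<omega>. W \<omega> ^ 2 \<partial>M) + h * \<mu>"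
  using integrable_W integrable_W2 by (simp add: \<mu>_def algebra_simps power2_eq_square)

lemma integrable_K:
  assumes "0 \<le> h" "0 \<le> m"
  shows "integrable M (\<lambda>\<omega>. W \<omega> * cut (W \<omega> * m + h))"
proof (rule Bochner_Integration.integrable_bound[OF integrable_linear[of m h]])
  show "AE \<omega> in M. norm (W \<omega> * cut (W \<omega> * m + h)) \<le> norm (W \<omega> * (W \<omega> * m + h))"
  proof (rule AE_I2)
    fix \<omega> assume w: "\<omega> \<in> space M"
    show "norm (W \<omega> * cut (W \<omega> * m + h)) \<le> norm (W \<omega> * (W \<omega> * m + h))"
      using cut_nonneg[of "W \<omega> * m + h"] cut_le[of "W \<omega> * m + h"] arg_nonneg[OF w assms(2,1)] W_pos[OF w]
      by (simp add: abs_mult)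
  qed
qed measurable

text \<open>The pointwise defect bounds at x = W m + h, averaged. By the choice of
  \<open>\<theta>c\<close> the linear term \<kappa> x averages to m/\<theta>c + \<kappa> h, so the
  middle expression is the averaged defect itself. Both asymptotic comparisons are read off from
  here.\<close>

lemma Phi_bounds:
  assumes "0 \<le> h" "0 \<le> m"
  shows "c * K h m \<le> \<mu> * (m / \<theta>c + \<kappa> * h - \<Phi> h m)"
    and "\<mu> * (m / \<theta>c + \<kappa> * h - \<Phi> h m) \<le> C * K h m"
proof -
  let ?x = "\<lambda>\<omega>. W \<omega> * m + h"
  let ?G = "\<lambda>\<omega>. \<kappa> * (W \<omega> * ?x \<omega>) - W \<omega> * f (?x \<omega>)"
  have int: "integrable M ?G"
    using integrable_linear integrable_W_f[OF assms] by (intro Bochner_Integration.integrable_diff integrable_mult_right)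
  have "(\<integral>\<omega>. ?G \<omega> \<partial>M) = \<kappa> * (m * (\<integral>\<omega>. W \<omega> ^ 2 \<partial>M) + h * \<mu>) - \<mu> * \<Phi> h m"
    using integrable_linear[of m h] integrable_W_f[OF assms] mu_pos
    by (subst Bochner_Integration.integral_diff) (auto simp: integral_linear \<Phi>_def)
  also have "\<dots> = \<mu> * (m / \<theta>c + \<kappa> * h - \<Phi> h m)"
    using mu_pos by (simp add: \<theta>c_def algebra_simps)
  finally have eq: "(\<integral>\<omega>. ?G \<omega> \<partial>M) = \<mu> * (m / \<theta>c + \<kappa> * h - \<Phi> h m)" .
  have G: "?G \<omega> = W \<omega> * (\<kappa> * ?x \<omega> - f (?x \<omega>))" for \<omega>
    by (simp add: algebra_simps)
  have "c * K h m = (\<integral>\<omega>. c * (W \<omega> * cut (?x \<omega>)) \<partial>M)" by (simp add: K_def)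
  also have "\<dots> \<le> (\<integral>\<omega>. ?G \<omega> \<partial>M)"
  proof (rule integral_mono[OF _ int])
    fix \<omega> assume w: "\<omega> \<in> space M"
    have "W \<omega> * (c * cut (?x \<omega>)) \<le> ?G \<omega>"
      unfolding G cut_def using W_pos[OF w] arg_nonneg[OF w assms(2,1)] by (intro mult_left_mono f_lower) auto
    then show "c * (W \<omega> * cut (?x \<omega>)) \<le> ?G \<omega>" by (simp add: mult_ac)
  qed (intro integrable_mult_right integrable_K assms)
  finally show "c * K h m \<le> \<mu> * (m / \<theta>c + \<kappa> * h - \<Phi> h m)" unfolding eq .
  have "(\<integral>\<omega>. ?G \<omega> \<partial>M) \<le> (\<integral>\<omega>. C * (W \<omega> * cut (?x \<omega>)) \<partial>M)"
  proof (rule integral_mono[OF int])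
    fix \<omega> assume w: "\<omega> \<in> space M"
    have "?G \<omega> \<le> W \<omega> * (C * cut (?x \<omega>))"
      unfolding G cut_def using W_pos[OF w] arg_nonneg[OF w assms(2,1)] by (intro mult_left_mono f_upper) auto
    then show "?G \<omega> \<le> C * (W \<omega> * cut (?x \<omega>))" by (simp add: mult_ac)
  qed (intro integrable_mult_right integrable_K assms)
  also have "\<dots> = C * K h m" by (simp add: K_def)
  finally show "\<mu> * (m / \<theta>c + \<kappa> * h - \<Phi> h m) \<le> C * K h m" unfolding eq .
qed

lemma integrable_L: "integrable M (\<lambda>\<omega>. W \<omega> ^ 2 * min 1 ((W \<omega> * m)\<^sup>2))"
proof (rule Bochner_Integration.integrable_bound[OF integrable_W2])
  show "AE \<omega> in M. norm (W \<omega> ^ 2 * min 1 ((W \<omega> * m)\<^sup>2)) \<le> norm (W \<omega> ^ 2)"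
    by (intro AE_I2) (simp add: abs_mult mult_left_le)
qed measurable

lemma L_pos:
  assumes "0 < m"
  shows "0 < L m"
  unfolding L_def using W_pos assms
  by (intro integral_pos integrable_L mult_pos_pos) (force simp: min_def)+

lemma L_mono:
  assumes "0 \<le> m" "m \<le> m'"
  shows "L m \<le> L m'"
  unfolding L_def
proof (rule integral_mono[OF integrable_L integrable_L])
  fix \<omega> assume w: "\<omega> \<in> space M"
  have "(W \<omega> * m)\<^sup>2 \<le> (W \<omega> * m')\<^sup>2"
    using assms W_pos[OF w] by (intro power_mono mult_left_mono) auto
  then show "W \<omega> ^ 2 * min 1 ((W \<omega> * m)\<^sup>2) \<le> W \<omega> ^ 2 * min 1 ((W \<omega> * m')\<^sup>2)"
    by (intro mult_left_mono min.mono) auto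
qed

lemma K_0:
  assumes "0 \<le> m"
  shows "K 0 m = m * L m"
proof -
  have "W \<omega> * cut (W \<omega> * m + 0) = m * (W \<omega> ^ 2 * min 1 ((W \<omega> * m)\<^sup>2))" if w: "\<omega> \<in> space M" for \<omega>
  proof -
    have "0 \<le> W \<omega> * m" using W_pos[OF w] assms by simp
    then have "min (W \<omega> * m) (W \<omega> * m * (W \<omega> * m)\<^sup>2) = W \<omega> * m * min 1 ((W \<omega> * m)\<^sup>2)"
      by (simp add: min_mult_distrib_left)
    then show ?thesis by (simp add: cut_def eval_nat_numeral mult_ac)
  qed
  then have "K 0 m = (\<integral>\<omega>. m * (W \<omega> ^ 2 * min 1 ((W \<omega> * m)\<^sup>2)) \<partial>M)"
    unfolding K_def by (intro Bochner_Integration.integral_cong refl)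
  then show ?thesis by (simp add: L_def)
qed

lemma K_lower:
  assumes "0 \<le> h" "0 \<le> m"
  shows "m * L m \<le> K h m"
  unfolding K_0[OF assms(2), symmetric] unfolding K_def
  using W_pos assms by (intro integral_mono integrable_K mult_left_mono cut_mono) (auto simp: less_imp_le)

text \<open>The doubling estimate separates W m from h. What the field costs is of order h^3,
  negligible against the linear term \<kappa> h.\<close>

lemma K_upper:
  assumes "0 \<le> h" "0 \<le> m"
  shows "K h m \<le> 8 * (m * L m + \<mu> * h ^ 3)"
proof -
  have "K h m \<le> (\<integral>\<omega>. 8 * (W \<omega> * cut (W \<omega> * m + 0)) + 8 * h ^ 3 * W \<omega> \<partial>M)"
    unfolding K_def
  proof (intro integral_mono)
    fix \<omega> assume w: "\<omega> \<in> space M"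
    have "cut (W \<omega> * m + h) \<le> 8 * (cut (W \<omega> * m) + h ^ 3)"
      using cut_add[of "W \<omega> * m" h] cut_le'[of h] W_pos[OF w] assms by simp
    then have "W \<omega> * cut (W \<omega> * m + h) \<le> W \<omega> * (8 * (cut (W \<omega> * m) + h ^ 3))"
      using W_pos[OF w] by (intro mult_left_mono) auto
    then show "W \<omega> * cut (W \<omega> * m + h) \<le> 8 * (W \<omega> * cut (W \<omega> * m + 0)) + 8 * h ^ 3 * W \<omega>"
      by (simp add: algebra_simps)
  qed (use assms integrable_W integrable_K[of h m] integrable_K[of 0 m] in auto)
  also have "\<dots> = 8 * K 0 m + 8 * h ^ 3 * \<mu>"
    unfolding K_def \<mu>_def using assms integrable_W integrable_K[of 0 m]
    by (subst Bochner_Integration.integral_add) auto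
  finally show ?thesis using K_0[OF assms(2)] by (simp add: algebra_simps)
qed

section \<open>Existence and uniqueness of the solutions\<close>

lemma Phi_le_1:
  assumes "0 \<le> h" "0 \<le> m"
  shows "\<Phi> h m \<le> 1"
proof -
  have "(\<integral>\<omega>. W \<omega> * f (W \<omega> * m + h) \<partial>M) \<le> \<mu>"
    unfolding \<mu>_def
  proof (intro integral_mono integrable_W integrable_W_f assms)
    fix \<omega> assume w: "\<omega> \<in> space M"
    show "W \<omega> * f (W \<omega> * m + h) \<le> W \<omega>"
      using f_le_1[OF arg_nonneg[OF w assms(2,1)]] W_pos[OF w] by (simp add: mult_left_le)
  qed
  then show ?thesis using mu_pos by (simp add: \<Phi>_def)
qed

lemma continuous_on_Phi:
  assumes "0 \<le> h"
  shows "continuous_on {0..} (\<Phi> h)"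
proof -
  have "(\<lambda>n. \<integral>\<omega>. W \<omega> * f (W \<omega> * x n + h) \<partial>M) \<longlonglongrightarrow> (\<integral>\<omega>. W \<omega> * f (W \<omega> * a + h) \<partial>M)"
    if x: "\<And>n. 0 \<le> x n" "x \<longlonglongrightarrow> a" for x :: "nat \<Rightarrow> real" and a
  proof (rule integral_dominated_convergence[where w = W])
    show "AE \<omega> in M. (\<lambda>n. W \<omega> * f (W \<omega> * x n + h)) \<longlonglongrightarrow> W \<omega> * f (W \<omega> * a + h)"
    proof (intro AE_I2 tendsto_intros)
      fix \<omega>
      show "(\<lambda>n. f (W \<omega> * x n + h)) \<longlonglongrightarrow> f (W \<omega> * a + h)"
        by (rule continuous_on_tendsto_compose[OF f_cont]) (auto intro!: tendsto_intros x(2))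
    qed
    fix n
    show "AE \<omega> in M. norm (W \<omega> * f (W \<omega> * x n + h)) \<le> W \<omega>"
    proof (rule AE_I2)
      fix \<omega> assume w: "\<omega> \<in> space M"
      have "0 \<le> f (W \<omega> * x n + h)" "f (W \<omega> * x n + h) \<le> 1"
        using f_nonneg f_le_1 arg_nonneg[OF w x(1) assms] by auto
      then show "norm (W \<omega> * f (W \<omega> * x n + h)) \<le> W \<omega>"
        using W_pos[OF w] by (simp add: abs_mult mult_left_le)
    qed
  qed (auto intro: integrable_W)
  then show ?thesis
    unfolding continuous_on_sequentially \<Phi>_def comp_def using mu_pos
    by (auto intro!: tendsto_divide)
qed

text \<open>With x = W m + h write f(x)/m = (f(x)/x) (x/m). The first factor decreases strictly in
  m, and x/m = W + h/m does not increase. Thus one argument covers zero and positive field.\<close>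

lemma Phi_ratio_decreasing:
  assumes "0 \<le> h" "0 < m" "m < m'"
  shows "\<Phi> h m' / m' < \<Phi> h m / m"
proof -
  have "(\<integral>\<omega>. W \<omega> * f (W \<omega> * m' + h) / m' \<partial>M) < (\<integral>\<omega>. W \<omega> * f (W \<omega> * m + h) / m \<partial>M)"
  proof (rule integral_less_AE_space)
    show "AE \<omega> in M. W \<omega> * f (W \<omega> * m' + h) / m' < W \<omega> * f (W \<omega> * m + h) / m"
    proof (rule AE_I2)
      fix \<omega> assume w: "\<omega> \<in> space M"
      let ?x = "W \<omega> * m + h" and ?x' = "W \<omega> * m' + h"
      have x: "0 < ?x" "?x < ?x'" using W_pos[OF w] assms by (auto intro: add_pos_nonneg)
      then have x': "0 < ?x'" by linarith
      have "h / m' \<le> h / m" using assms by (intro divide_left_mono) auto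
      then have le: "?x' / m' \<le> ?x / m" using assms by (simp add: add_divide_distrib)
      have "f ?x' / m' = (f ?x' / ?x') * (?x' / m')" using x' by simp
      also have "\<dots> < (f ?x / ?x) * (?x' / m')"
        using f_ratio[OF x] x' assms by (intro mult_strict_right_mono) auto
      also have "\<dots> \<le> (f ?x / ?x) * (?x / m)"
        using le x f_pos[OF x(1)] by (intro mult_left_mono) auto
      also have "\<dots> = f ?x / m" using x by simp
      finally have "W \<omega> * (f ?x' / m') < W \<omega> * (f ?x / m)"
        using W_pos[OF w] by (rule mult_strict_left_mono)
      then show "W \<omega> * f ?x' / m' < W \<omega> * f ?x / m" by simp
    qed
  qed (use assms integrable_W_f[of h m] integrable_W_f[of h m'] in \<open>auto simp: emeasure_space_1\<close>)
  from divide_strict_right_mono[OF this mu_pos] show ?thesis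
    by (simp add: \<Phi>_def mult.commute)
qed

lemma fixed_point_unique:
  assumes "0 \<le> h" "0 < m" "0 < m'" "m / \<theta> = \<Phi> h m" "m' / \<theta> = \<Phi> h m'"
  shows "m = m'"
proof -
  have False if "0 < x" "x < y" "x / \<theta> = \<Phi> h x" "y / \<theta> = \<Phi> h y" for x y
  proof -
    have "\<Phi> h x / x = 1 / \<theta>" using that(1) unfolding that(3)[symmetric] by simp
    moreover have "\<Phi> h y / y = 1 / \<theta>" using that(1,2) unfolding that(4)[symmetric] by simp
    ultimately show False using Phi_ratio_decreasing[OF assms(1) that(1,2)] by simp
  qed
  then show ?thesis using assms by (metis linorder_neqE_linordered_idom)
qed

text \<open>The line m/\<theta> starts below \<Phi> at \<open>a\<close> and is at least 1, an upper
  bound for \<Phi>, at \<open>max a \<theta>\<close>. A positive left end \<open>a\<close> keeps the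
  trivial solution out at zero field.\<close>

lemma fixed_point_exists:
  assumes "0 \<le> h" "0 < \<theta>" "0 \<le> a" "a / \<theta> \<le> \<Phi> h a"
  shows "\<exists>m\<ge>a. m / \<theta> = \<Phi> h m"
proof -
  let ?b = "max a \<theta>"
  let ?g = "\<lambda>m. m / \<theta> - \<Phi> h m"
  have "\<exists>m. a \<le> m \<and> m \<le> ?b \<and> ?g m = 0"
  proof (rule IVT')
    have "1 \<le> ?b / \<theta>" using assms by (simp add: field_simps)
    moreover have "\<Phi> h ?b \<le> 1" using assms by (intro Phi_le_1) auto
    ultimately show "0 \<le> ?g ?b" by linarith
    show "continuous_on {a..?b} ?g"
      using assms by (intro continuous_intros continuous_on_subset[OF continuous_on_Phi]) auto
  qed (use assms in auto)
  then show ?thesis by auto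
qed

text \<open>A sequence is enough, since existence needs only one positive point at which
  \<open>L\<close> is small.\<close>

lemma L_tendsto_0: "(\<lambda>n. L (1 / Suc n)) \<longlonglongrightarrow> 0"
proof -
  have "(\<lambda>n. \<integral>\<omega>. W \<omega> ^ 2 * min 1 ((W \<omega> * (1 / Suc n))\<^sup>2) \<partial>M) \<longlonglongrightarrow> (\<integral>\<omega>. 0 \<partial>M)"
  proof (rule integral_dominated_convergence[OF _ _ integrable_W2])
    show "AE \<omega> in M. (\<lambda>n. W \<omega> ^ 2 * min 1 ((W \<omega> * (1 / Suc n))\<^sup>2)) \<longlonglongrightarrow> 0"
    proof (rule AE_I2)
      fix \<omega>
      have "(\<lambda>n. 1 / Suc n) \<longlonglongrightarrow> (0::real)" using LIMSEQ_inverse_real_of_nat by (simp add: inverse_eq_divide)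
      then have "(\<lambda>n. W \<omega> ^ 2 * min 1 ((W \<omega> * (1 / Suc n))\<^sup>2)) \<longlonglongrightarrow> W \<omega> ^ 2 * min 1 ((W \<omega> * 0)\<^sup>2)"
        by (intro tendsto_intros)
      then show "(\<lambda>n. W \<omega> ^ 2 * min 1 ((W \<omega> * (1 / Suc n))\<^sup>2)) \<longlonglongrightarrow> 0" by simp
    qed
    show "AE \<omega> in M. norm (W \<omega> ^ 2 * min 1 ((W \<omega> * (1 / Suc n))\<^sup>2)) \<le> W \<omega> ^ 2" for n
      by (intro AE_I2) (simp add: abs_mult mult_left_le)
  qed auto
  then show ?thesis by (simp add: L_def)
qed

lemma ex1_fixed_point_zero_field:
  assumes "\<theta>c < \<theta>"
  shows "\<exists>!m. 0 < m \<and> m / \<theta> = \<Phi> 0 m"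
proof -
  have th: "0 < \<theta>" using assms theta_c_pos by simp
  \<comment> \<open>Chosen so that L(a) < \<epsilon> keeps the defect bound C a L(a) below \<mu> a
    (1/\<theta>c - 1/\<theta>); then a/\<theta> lies below \<Phi>(a).\<close>
  define \<epsilon> where "\<epsilon> = \<mu> * (1 / \<theta>c - 1 / \<theta>) / C"
  have "1 / \<theta> < 1 / \<theta>c" using assms theta_c_pos by (simp add: field_simps)
  then have "0 < \<epsilon>" using mu_pos C_pos by (simp add: \<epsilon>_def)
  then obtain n where n: "L (1 / Suc n) < \<epsilon>"
    using order_tendstoD(2)[OF L_tendsto_0] unfolding eventually_sequentially by blast
  let ?a = "1 / Suc n"
  have "\<mu> * (?a / \<theta>c - \<Phi> 0 ?a) \<le> C * (?a * L ?a)"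
    using Phi_bounds(2)[of 0 ?a] K_0[of ?a] by simp
  also have "\<dots> \<le> C * (?a * \<epsilon>)"
    using n C_pos by (intro mult_left_mono) auto
  also have "\<dots> = \<mu> * (?a * (1 / \<theta>c - 1 / \<theta>))"
    using C_pos unfolding \<epsilon>_def by simp
  also have "?a * (1 / \<theta>c - 1 / \<theta>) = ?a / \<theta>c - ?a / \<theta>"
    by (simp only: right_diff_distrib times_divide_eq_right mult_1_right)
  finally have "?a / \<theta> \<le> \<Phi> 0 ?a" using mu_pos by simp
  then obtain m where "?a \<le> m" "m / \<theta> = \<Phi> 0 m"
    using fixed_point_exists[of 0 \<theta> ?a] th by auto
  moreover have "0 < ?a" by simp
  ultimately have "0 < m \<and> m / \<theta> = \<Phi> 0 m" by linarith
  then show ?thesis using fixed_point_unique[of 0] by blast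
qed

lemma Phi_at_0: "\<Phi> h 0 = f h"
  using mu_pos by (simp add: \<Phi>_def \<mu>_def)

text \<open>A field gives \<Phi> the positive value f(h) at 0, so uniqueness among positive
  solutions extends to nonnegative ones.\<close>

lemma fixed_point_field_nonzero:
  assumes "0 < h" "m / \<theta> = \<Phi> h m"
  shows "m \<noteq> 0"
  using assms(2) Phi_at_0[of h] f_pos[OF assms(1)] by auto

lemma ex1_fixed_point_field:
  assumes "0 < h" "0 < \<theta>"
  shows "\<exists>!m. 0 \<le> m \<and> m / \<theta> = \<Phi> h m"
proof -
  have "0 / \<theta> \<le> \<Phi> h 0" using Phi_at_0[of h] f_pos[OF assms(1)] by simp
  then obtain m where m: "0 \<le> m" "m / \<theta> = \<Phi> h m"
    using fixed_point_exists[of h \<theta> 0] assms by auto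
  show ?thesis
  proof (rule ex1I[of _ m])
    fix m' assume m': "0 \<le> m' \<and> m' / \<theta> = \<Phi> h m'"
    have "m \<noteq> 0" "m' \<noteq> 0"
      using fixed_point_field_nonzero[OF assms(1)] m m' by blast+
    then show "m' = m"
      using fixed_point_unique[of h m' m \<theta>] m m' assms by simp
  qed (use m in blast)
qed

end

section \<open>Asymptotic inversion\<close>

text \<open>Were m(x) \<ge> a > 0, monotonicity would keep \<Lambda>(m(x)) above the positive number
  \<Lambda>(a). Neither continuity nor an inverse of \<Lambda> is involved.\<close>

lemma filterlim_at_right_0_if_mono:
  fixes \<Lambda> m :: "_ \<Rightarrow> real"
  assumes mono: "\<And>x y. 0 < x \<Longrightarrow> x \<le> y \<Longrightarrow> \<Lambda> x \<le> \<Lambda> y"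
    and pos: "\<And>x. 0 < x \<Longrightarrow> 0 < \<Lambda> x"
    and m: "eventually (\<lambda>x. 0 < m x) F"
    and lim: "((\<lambda>x. \<Lambda> (m x)) \<longlongrightarrow> 0) F"
  shows "filterlim m (at_right 0) F"
  unfolding filterlim_at
proof
  show "eventually (\<lambda>x. m x \<in> {0<..} \<and> m x \<noteq> 0) F"
    using m by eventually_elim auto
  show "(m \<longlongrightarrow> 0) F"
  proof (rule order_tendstoI)
    fix a :: real assume "a < 0"
    then show "eventually (\<lambda>x. a < m x) F" using m by (auto elim: eventually_mono)
  next
    fix a :: real assume a: "0 < a"
    show "eventually (\<lambda>x. m x < a) F"
      using order_tendstoD(2)[OF lim pos[OF a]]
    proof eventually_elim
      case (elim x)
      then show ?case using mono[OF a, of "m x"] by force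
    qed
  qed
qed

lemma bigo_tendsto_0:
  fixes f g :: "'a \<Rightarrow> real"
  assumes "f \<in> O[F](g)" "(g \<longlongrightarrow> 0) F"
  shows "(f \<longlongrightarrow> 0) F"
proof -
  obtain c where c: "eventually (\<lambda>x. norm (f x) \<le> c * norm (g x)) F"
    using assms(1) by (rule landau_o.bigE)
  have "((\<lambda>x. c * norm (g x)) \<longlongrightarrow> c * norm (0::real)) F"
    by (intro tendsto_intros assms)
  then show ?thesis using c by (intro Lim_null_comparison[OF c]) simp
qed

lemma bigtheta_invert_powr:
  fixes m \<epsilon> :: "'a \<Rightarrow> real"
  assumes q: "0 < q"
    and \<Lambda>: "\<Lambda> \<in> \<Theta>[at_right 0](\<lambda>y. y powr q)"
    and m: "filterlim m (at_right 0) F"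
    and \<epsilon>: "eventually (\<lambda>x. 0 < \<epsilon> x) F"
    and \<Lambda>m: "(\<lambda>x. \<Lambda> (m x)) \<in> \<Theta>[F](\<epsilon>)"
  shows "m \<in> \<Theta>[F](\<lambda>x. \<epsilon> x powr (1 / q))"
proof -
  have "(\<lambda>x. m x powr q) \<in> \<Theta>[F](\<lambda>x. \<Lambda> (m x))"
    by (rule bigtheta_sym[THEN iffD1, OF landau_theta.compose[OF \<Lambda> m]])
  also note \<Lambda>m
  finally have *: "(\<lambda>x. m x powr q) \<in> \<Theta>[F](\<epsilon>)" .
  have "eventually (\<lambda>x. 0 < m x) F"
    using m unfolding filterlim_at by (auto elim: eventually_mono)
  \<comment> \<open>The absolute value brings the term into the form of
    \<open>bigtheta_powr\<close>.\<close>
  then have "eventually (\<lambda>x. m x = \<bar>m x powr q\<bar> powr (1 / q)) F"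
    by eventually_elim (use q in \<open>simp add: powr_powr\<close>)
  then have "m \<in> \<Theta>[F](\<lambda>x. \<bar>m x powr q\<bar> powr (1 / q))" by (rule bigthetaI_cong)
  also note bigtheta_powr[OF *]
  also have "eventually (\<lambda>x. \<bar>\<epsilon> x\<bar> powr (1 / q) = \<epsilon> x powr (1 / q)) F"
    using \<epsilon> by eventually_elim simp
  then have "(\<lambda>x. \<bar>\<epsilon> x\<bar> powr (1 / q)) \<in> \<Theta>[F](\<lambda>x. \<epsilon> x powr (1 / q))" by (rule bigthetaI_cong)
  finally show ?thesis .
qed

text \<open>Once ln(1/m) and ln(1/\<epsilon>) are known to be of the same order, dividing by the
  logarithm reduces the claim to the pure power case with \<epsilon> / ln(1/\<epsilon>) in place of
  \<epsilon>.\<close>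

lemma bigtheta_invert_powr_ln:
  fixes m \<epsilon> :: "'a \<Rightarrow> real"
  assumes q: "0 < q"
    and \<Lambda>: "\<Lambda> \<in> \<Theta>[at_right 0](\<lambda>y. y powr q * ln (1 / y))"
    and m: "filterlim m (at_right 0) F"
    and \<epsilon>: "eventually (\<lambda>x. 0 < \<epsilon> x) F" "eventually (\<lambda>x. \<epsilon> x < 1) F"
    and \<Lambda>m: "(\<lambda>x. \<Lambda> (m x)) \<in> \<Theta>[F](\<epsilon>)"
  shows "m \<in> \<Theta>[F](\<lambda>x. (\<epsilon> x / ln (1 / \<epsilon> x)) powr (1 / q))"
proof -
  let ?g = "\<lambda>y::real. y powr q * ln (1 / y)"
  have "(\<lambda>x. ?g (m x)) \<in> \<Theta>[F](\<lambda>x. \<Lambda> (m x))"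
    by (rule bigtheta_sym[THEN iffD1, OF landau_theta.compose[OF \<Lambda> m]])
  also note \<Lambda>m
  finally have g\<epsilon>: "(\<lambda>x. ?g (m x)) \<in> \<Theta>[F](\<epsilon>)" .
  obtain a where a: "0 < a" "eventually (\<lambda>x. norm (\<epsilon> x) \<le> a * norm (?g (m x))) F"
    using bigthetaD1[OF bigtheta_sym[THEN iffD1, OF g\<epsilon>]] by (rule landau_o.bigE)
  obtain d where d: "0 < d" "eventually (\<lambda>x. norm (?g (m x)) \<le> d * norm (\<epsilon> x)) F"
    using bigthetaD1[OF g\<epsilon>] by (rule landau_o.bigE)
  have ev: "eventually (\<lambda>x. P (m x)) F" if "eventually P (at_right 0)" for P
    using that m by (simp add: filterlim_iff)
  \<comment> \<open>Moving the exponent q to q/2 and to 2q absorbs both the constants and the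
    logarithm, so \<epsilon> lies between m^(2q) and m^(q/2). On taking logarithms the exponents
    become mere factors.\<close>
  have "eventually (\<lambda>y. a * ?g y \<le> y powr (q / 2)) (at_right 0)"
    "eventually (\<lambda>y. d * y powr (2 * q) \<le> ?g y) (at_right 0)"
    using q a(1) d(1) by real_asymp+
  note ev_bounds = this[THEN ev]
  have "eventually (\<lambda>y::real. y \<in> {0<..<1}) (at_right 0)"
    by (intro eventually_at_right_real) simp
  then have ev01: "eventually (\<lambda>x. 0 < m x \<and> m x < 1) F"
    by (intro ev) simp
  have nz: "eventually (\<lambda>x. ln (1 / m x) \<noteq> 0) F"
    using ev01 by eventually_elim (auto simp: ln_div)
  have nz': "eventually (\<lambda>x. ln (1 / \<epsilon> x) \<noteq> 0) F"
    using \<epsilon> by eventually_elim (auto simp: ln_div)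
  have "eventually (\<lambda>x. (q / 2) * norm (ln (1 / m x)) \<le> norm (ln (1 / \<epsilon> x)) \<and>
      norm (ln (1 / \<epsilon> x)) \<le> (2 * q) * norm (ln (1 / m x))) F"
    using ev_bounds ev01 a(2) d(2) \<epsilon>
  proof eventually_elim
    case (elim x)
    have pos: "0 < ?g (m x)" using elim by (intro mult_pos_pos) auto
    have "\<epsilon> x \<le> m x powr (q / 2)" using elim pos by simp
    then have "ln (\<epsilon> x) \<le> ln (m x powr (q / 2))" using elim by (subst ln_le_cancel_iff) auto
    also have "\<dots> = q / 2 * ln (m x)" using elim by (simp add: ln_powr)
    finally have 1: "ln (\<epsilon> x) \<le> q / 2 * ln (m x)" .
    have "d * m x powr (2 * q) \<le> d * \<epsilon> x" using elim pos by simp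
    then have "m x powr (2 * q) \<le> \<epsilon> x" using d(1) by simp
    then have "ln (m x powr (2 * q)) \<le> ln (\<epsilon> x)" using elim by (subst ln_le_cancel_iff) auto
    moreover have "ln (m x powr (2 * q)) = 2 * q * ln (m x)" using elim by (simp add: ln_powr)
    ultimately have 2: "2 * q * ln (m x) \<le> ln (\<epsilon> x)" by simp
    show ?case using 1 2 elim by (simp add: ln_div)
  qed
  then have ln_bigtheta: "(\<lambda>x. ln (1 / \<epsilon> x)) \<in> \<Theta>[F](\<lambda>x. ln (1 / m x))"
    using q by (intro bigthetaI'[of "q / 2" "2 * q"]) auto
  have "eventually (\<lambda>x. m x powr q = ?g (m x) / ln (1 / m x)) F"
    using nz by eventually_elim simp
  then have "(\<lambda>x. m x powr q) \<in> \<Theta>[F](\<lambda>x. ?g (m x) / ln (1 / m x))" by (rule bigthetaI_cong)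
  also have "(\<lambda>x. ?g (m x) / ln (1 / m x)) \<in> \<Theta>[F](\<lambda>x. \<epsilon> x / ln (1 / \<epsilon> x))"
    using nz nz' g\<epsilon> ln_bigtheta
    by (intro landau_theta.divide)
  finally have "(\<lambda>x. m x powr q) \<in> \<Theta>[F](\<lambda>x. \<epsilon> x / ln (1 / \<epsilon> x))"
    using landau_theta.in_cong by fastforce
  moreover have "eventually (\<lambda>x. 0 < \<epsilon> x / ln (1 / \<epsilon> x)) F"
    using \<epsilon> by eventually_elim (auto intro!: divide_pos_pos)
  ultimately show ?thesis
    using q m by (intro bigtheta_invert_powr[where \<Lambda> = "\<lambda>y. y powr q"]) auto
qed

section \<open>Order of the solutions near the critical point\<close>

context mean_field
begin

definition spont :: "real \<Rightarrow> real" where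
  "spont \<theta> = (THE m. 0 < m \<and> m / \<theta> = \<Phi> 0 m)"

definition crit :: "real \<Rightarrow> real" where
  "crit h = (THE m. 0 \<le> m \<and> m / \<theta>c = \<Phi> h m)"

lemma spont:
  assumes "\<theta>c < \<theta>"
  shows "0 < spont \<theta>" "spont \<theta> / \<theta> = \<Phi> 0 (spont \<theta>)"
  using theI'[OF ex1_fixed_point_zero_field[OF assms]] by (simp_all add: spont_def)

lemma crit:
  assumes "0 < h"
  shows "0 < crit h" "crit h / \<theta>c = \<Phi> h (crit h)"
proof -
  have *: "0 \<le> crit h" "crit h / \<theta>c = \<Phi> h (crit h)"
    using theI'[OF ex1_fixed_point_field[OF assms theta_c_pos]] by (simp_all add: crit_def)
  show "crit h / \<theta>c = \<Phi> h (crit h)" by fact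
  show "0 < crit h" using * fixed_point_field_nonzero[OF assms *(2)] by simp
qed

text \<open>At a zero-field solution the defect is m (1/\<theta>c - 1/\<theta>), and it is
  comparable to K(0, m) = m L(m). The common factor m cancels.\<close>

lemma L_spont_bigtheta: "(\<lambda>\<theta>. L (spont \<theta>)) \<in> \<Theta>[at_right \<theta>c](\<lambda>\<theta>. \<theta> - \<theta>c)"
proof (rule bigthetaI'[of "\<mu> / (2 * C * \<theta>c\<^sup>2)" "\<mu> / (c * \<theta>c\<^sup>2)"])
  show "eventually (\<lambda>\<theta>. \<mu> / (2 * C * \<theta>c\<^sup>2) * norm (\<theta> - \<theta>c) \<le> norm (L (spont \<theta>)) \<and>
      norm (L (spont \<theta>)) \<le> \<mu> / (c * \<theta>c\<^sup>2) * norm (\<theta> - \<theta>c)) (at_right \<theta>c)"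
  proof (rule eventually_mono)
    \<comment> \<open>Below 2 \<theta>c the denominator \<theta> \<theta>c agrees with \<theta>c^2
      up to the factor 2 in the lower constant.\<close>
    show "eventually (\<lambda>\<theta>. \<theta> \<in> {\<theta>c<..<2 * \<theta>c}) (at_right \<theta>c)"
      using theta_c_pos by (intro eventually_at_right_real) simp
    fix \<theta> assume "\<theta> \<in> {\<theta>c<..<2 * \<theta>c}"
    then have th: "\<theta>c < \<theta>" "\<theta> < 2 * \<theta>c" by auto
    let ?m = "spont \<theta>"
    note m = spont[OF th(1)]
    have eq: "?m / \<theta>c + \<kappa> * 0 - \<Phi> 0 ?m = ?m * ((\<theta> - \<theta>c) / (\<theta> * \<theta>c))"
      unfolding m(2)[symmetric] using th theta_c_pos by (simp add: field_simps)
    have "c * (?m * L ?m) \<le> \<mu> * (?m * ((\<theta> - \<theta>c) / (\<theta> * \<theta>c)))"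
      using Phi_bounds(1)[of 0 ?m] m(1) K_0[of ?m] unfolding eq by simp
    then have "?m * (c * L ?m) \<le> ?m * (\<mu> * ((\<theta> - \<theta>c) / (\<theta> * \<theta>c)))" by (simp only: mult_ac)
    then have 1: "c * L ?m \<le> \<mu> * ((\<theta> - \<theta>c) / (\<theta> * \<theta>c))" using m(1) by (rule mult_left_le_imp_le)
    have "\<mu> * (?m * ((\<theta> - \<theta>c) / (\<theta> * \<theta>c))) \<le> C * (?m * L ?m)"
      using Phi_bounds(2)[of 0 ?m] m(1) K_0[of ?m] unfolding eq by simp
    then have "?m * (\<mu> * ((\<theta> - \<theta>c) / (\<theta> * \<theta>c))) \<le> ?m * (C * L ?m)" by (simp only: mult_ac)
    then have 2: "\<mu> * ((\<theta> - \<theta>c) / (\<theta> * \<theta>c)) \<le> C * L ?m" using m(1) by (rule mult_left_le_imp_le)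
    have "(\<theta> - \<theta>c) / (\<theta> * \<theta>c) \<le> (\<theta> - \<theta>c) / \<theta>c\<^sup>2"
      using th theta_c_pos by (intro divide_left_mono) (auto simp: power2_eq_square)
    then have "\<mu> * ((\<theta> - \<theta>c) / (\<theta> * \<theta>c)) \<le> \<mu> * ((\<theta> - \<theta>c) / \<theta>c\<^sup>2)"
      using mu_pos by (intro mult_left_mono) auto
    with 1 have "L ?m \<le> \<mu> * ((\<theta> - \<theta>c) / \<theta>c\<^sup>2) / c"
      using c_pos by (subst pos_le_divide_eq) (simp_all add: mult.commute)
    then have u: "L ?m \<le> \<mu> / (c * \<theta>c\<^sup>2) * (\<theta> - \<theta>c)" by (simp add: mult.commute)
    have "(\<theta> - \<theta>c) / (2 * \<theta>c\<^sup>2) \<le> (\<theta> - \<theta>c) / (\<theta> * \<theta>c)"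
      using th theta_c_pos by (intro divide_left_mono) (auto simp: power2_eq_square)
    then have "\<mu> * ((\<theta> - \<theta>c) / (2 * \<theta>c\<^sup>2)) \<le> \<mu> * ((\<theta> - \<theta>c) / (\<theta> * \<theta>c))"
      using mu_pos by (intro mult_left_mono) auto
    with 2 have "\<mu> * ((\<theta> - \<theta>c) / (2 * \<theta>c\<^sup>2)) / C \<le> L ?m"
      using C_pos by (subst pos_divide_le_eq) (simp_all add: mult.commute)
    then have l: "\<mu> / (2 * C * \<theta>c\<^sup>2) * (\<theta> - \<theta>c) \<le> L ?m" by (simp add: mult_ac)
    show "\<mu> / (2 * C * \<theta>c\<^sup>2) * norm (\<theta> - \<theta>c) \<le> norm (L ?m) \<and>
      norm (L ?m) \<le> \<mu> / (c * \<theta>c\<^sup>2) * norm (\<theta> - \<theta>c)"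
      using l u th L_pos[OF m(1)] by simp
  qed
qed (use mu_pos theta_c_pos c_pos C_pos in auto)

text \<open>At \<theta> = \<theta>c the terms m/\<theta>c and \<Phi> cancel exactly, and the defect
  is \<kappa> h.\<close>

lemma L_crit_bigtheta: "(\<lambda>h. crit h * L (crit h)) \<in> \<Theta>[at_right 0](\<lambda>h. h)"
proof (rule bigthetaI'[of "\<mu> * \<kappa> / (16 * C)" "\<mu> * \<kappa> / c"])
  \<comment> \<open>The cubic term of \<open>K_upper\<close> is absorbed by half of \<kappa> h; this
    turns 8 C into 16 C in the lower constant.\<close>
  have "eventually (\<lambda>h::real. 8 * C * h ^ 3 \<le> \<kappa> / 2 * h) (at_right 0)"
    using kappa_pos C_pos by real_asymp
  then show "eventually (\<lambda>h. \<mu> * \<kappa> / (16 * C) * norm h \<le> norm (crit h * L (crit h)) \<and>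
      norm (crit h * L (crit h)) \<le> \<mu> * \<kappa> / c * norm h) (at_right 0)"
    using eventually_at_right_less[of 0]
  proof eventually_elim
    case (elim h)
    let ?m = "crit h"
    note m = crit[of h]
    have "c * (?m * L ?m) \<le> c * K h ?m" using elim m c_pos by (intro mult_left_mono K_lower) auto
    also have "\<dots> \<le> \<mu> * (\<kappa> * h)" using Phi_bounds(1)[of h ?m] m elim by simp
    finally have u: "?m * L ?m \<le> \<mu> * \<kappa> / c * h" using c_pos by (simp add: field_simps)
    have "\<mu> * (\<kappa> * h) \<le> C * K h ?m" using Phi_bounds(2)[of h ?m] m elim by simp
    also have "\<dots> \<le> C * (8 * (?m * L ?m + \<mu> * h ^ 3))" using elim m C_pos by (intro mult_left_mono K_upper) auto
    also have "\<dots> = 8 * C * (?m * L ?m) + \<mu> * (8 * C * h ^ 3)" by (simp add: algebra_simps)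
    also have "\<dots> \<le> 8 * C * (?m * L ?m) + \<mu> * (\<kappa> / 2 * h)"
      using elim mu_pos by (intro add_left_mono mult_left_mono) auto
    finally have l: "\<mu> * \<kappa> / (16 * C) * h \<le> ?m * L ?m" using C_pos by (simp add: field_simps)
    show ?case using l u elim m(1) L_pos[OF m(1)] by simp
  qed
qed (use mu_pos kappa_pos c_pos C_pos in auto)

lemma spont_tendsto_0: "filterlim spont (at_right 0) (at_right \<theta>c)"
proof (rule filterlim_at_right_0_if_mono)
  show "eventually (\<lambda>\<theta>. 0 < spont \<theta>) (at_right \<theta>c)"
    using eventually_at_right_less by (rule eventually_mono) (rule spont)
  have "((\<lambda>\<theta>. \<theta> - \<theta>c) \<longlongrightarrow> \<theta>c - \<theta>c) (at_right \<theta>c)" by (intro tendsto_intros)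
  then have "((\<lambda>\<theta>. \<theta> - \<theta>c) \<longlongrightarrow> 0) (at_right \<theta>c)" by simp
  then show "((\<lambda>\<theta>. L (spont \<theta>)) \<longlongrightarrow> 0) (at_right \<theta>c)"
    by (rule bigo_tendsto_0[OF bigthetaD1[OF L_spont_bigtheta]])
qed (auto intro: L_mono L_pos)

lemma crit_tendsto_0: "filterlim crit (at_right 0) (at_right 0)"
proof (rule filterlim_at_right_0_if_mono)
  show "eventually (\<lambda>h. 0 < crit h) (at_right 0)"
    using eventually_at_right_less by (rule eventually_mono) (rule crit)
  have "((\<lambda>h. h) \<longlongrightarrow> (0::real)) (at_right 0)" by (intro tendsto_intros)
  then show "((\<lambda>h. crit h * L (crit h)) \<longlongrightarrow> 0) (at_right 0)"
    by (rule bigo_tendsto_0[OF bigthetaD1[OF L_crit_bigtheta]])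
  show "x * L x \<le> y * L y" if "0 < x" "x \<le> y" for x y
    using that by (intro mult_mono L_mono) (auto intro: less_imp_le[OF L_pos])
qed (auto intro: L_pos mult_pos_pos)

lemma spont_powr:
  assumes "0 < q" "L \<in> \<Theta>[at_right 0](\<lambda>y. y powr q)"
  shows "spont \<in> \<Theta>[at_right \<theta>c](\<lambda>\<theta>. (\<theta> - \<theta>c) powr (1 / q))"
  using eventually_at_right_less[of \<theta>c]
  by (intro bigtheta_invert_powr[OF assms spont_tendsto_0 _ L_spont_bigtheta]) (auto elim: eventually_mono)

text \<open>The extra factor m on the critical isotherm raises the exponent to be inverted from q to
  q + 1. The factor \<open>r\<close> is 1 or the logarithm.\<close>

lemma times_L_bigtheta:
  assumes "L \<in> \<Theta>[at_right 0](\<lambda>y. y powr q * r y)"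
  shows "(\<lambda>y. y * L y) \<in> \<Theta>[at_right 0](\<lambda>y. y powr (q + 1) * r y)"
proof -
  have "(\<lambda>y. y * L y) \<in> \<Theta>[at_right 0](\<lambda>y. y * (y powr q * r y))"
    using assms by (intro landau_theta.mult) auto
  also have "eventually (\<lambda>y. y * (y powr q * r y) = y powr (q + 1) * r y) (at_right 0)"
    using eventually_at_right_less[of "0::real"] by eventually_elim (simp add: powr_add)
  then have "\<Theta>[at_right 0](\<lambda>y. y * (y powr q * r y)) = \<Theta>[at_right 0](\<lambda>y. y powr (q + 1) * r y)"
    by (rule landau_theta.cong)
  finally show ?thesis .
qed

lemma crit_powr:
  assumes "0 < q" "L \<in> \<Theta>[at_right 0](\<lambda>y. y powr q)"
  shows "crit \<in> \<Theta>[at_right 0](\<lambda>h. h powr (1 / (q + 1)))"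
  using times_L_bigtheta[of q "\<lambda>_. 1"] assms eventually_at_right_less[of "0::real"]
  by (intro bigtheta_invert_powr[OF _ _ crit_tendsto_0 _ L_crit_bigtheta]) auto

lemma spont_powr_ln:
  assumes "0 < q" "L \<in> \<Theta>[at_right 0](\<lambda>y. y powr q * ln (1 / y))"
  shows "spont \<in> \<Theta>[at_right \<theta>c](\<lambda>\<theta>. ((\<theta> - \<theta>c) / ln (1 / (\<theta> - \<theta>c))) powr (1 / q))"
proof -
  have "eventually (\<lambda>\<theta>. \<theta> \<in> {\<theta>c<..<\<theta>c + 1}) (at_right \<theta>c)"
    by (intro eventually_at_right_real) simp
  then show ?thesis
    by (intro bigtheta_invert_powr_ln[OF assms spont_tendsto_0 _ _ L_spont_bigtheta]) (auto elim: eventually_mono)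
qed

lemma crit_powr_ln:
  assumes "0 < q" "L \<in> \<Theta>[at_right 0](\<lambda>y. y powr q * ln (1 / y))"
  shows "crit \<in> \<Theta>[at_right 0](\<lambda>h. (h / ln (1 / h)) powr (1 / (q + 1)))"
proof -
  have "eventually (\<lambda>h::real. h \<in> {0<..<1}) (at_right 0)"
    by (intro eventually_at_right_real) simp
  then show ?thesis using times_L_bigtheta[OF assms(2)] assms(1)
    by (intro bigtheta_invert_powr_ln[OF _ _ crit_tendsto_0 _ _ L_crit_bigtheta]) (auto elim: eventually_mono)
qed

section \<open>Truncated moments of the weight\<close>

text \<open>The upper bound drops the truncation. The lower one uses y^2 min(1, W^2) \<le> min(1, (W
  y)^2) for y < 1, so \<open>L 1\<close> serves as constant.\<close>

lemma L_bigtheta_fourth_moment: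
  assumes "integrable M (\<lambda>\<omega>. W \<omega> ^ 4)"
  shows "L \<in> \<Theta>[at_right 0](\<lambda>y. y powr 2)"
proof -
  define E where "E = (\<integral>\<omega>. W \<omega> ^ 4 \<partial>M)"
  have E: "L y \<le> E * y\<^sup>2" for y
  proof -
    have "L y \<le> (\<integral>\<omega>. y\<^sup>2 * W \<omega> ^ 4 \<partial>M)"
      unfolding L_def
    proof (intro integral_mono integrable_L integrable_mult_right assms)
      fix \<omega>
      have "W \<omega> ^ 2 * min 1 ((W \<omega> * y)\<^sup>2) \<le> W \<omega> ^ 2 * (W \<omega> * y)\<^sup>2" by (intro mult_left_mono) auto
      then show "W \<omega> ^ 2 * min 1 ((W \<omega> * y)\<^sup>2) \<le> y\<^sup>2 * W \<omega> ^ 4"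
        by (simp add: power_mult_distrib eval_nat_numeral mult_ac)
    qed
    then show ?thesis by (simp add: E_def mult.commute)
  qed
  have L1: "L 1 * y\<^sup>2 \<le> L y" if "0 < y" "y < 1" for y
  proof -
    have "(\<integral>\<omega>. y\<^sup>2 * (W \<omega> ^ 2 * min 1 ((W \<omega> * 1)\<^sup>2)) \<partial>M) \<le> L y"
      unfolding L_def
    proof (intro integral_mono integrable_mult_right integrable_L)
      fix \<omega>
      have "y\<^sup>2 \<le> 1" using that by (simp add: power_le_one)
      then have "y\<^sup>2 * min 1 ((W \<omega>)\<^sup>2) \<le> min 1 ((W \<omega> * y)\<^sup>2)"
        by (simp add: min_mult_distrib_left power_mult_distrib mult.commute min.coboundedI1)
      then have "W \<omega> ^ 2 * (y\<^sup>2 * min 1 ((W \<omega>)\<^sup>2)) \<le> W \<omega> ^ 2 * min 1 ((W \<omega> * y)\<^sup>2)"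
        by (intro mult_left_mono) auto
      then show "y\<^sup>2 * (W \<omega> ^ 2 * min 1 ((W \<omega> * 1)\<^sup>2)) \<le> W \<omega> ^ 2 * min 1 ((W \<omega> * y)\<^sup>2)"
        by (simp add: mult_ac)
    qed
    then show ?thesis by (simp add: L_def mult.commute)
  qed
  have "0 < E" using E[of 1] L_pos[of 1] by simp
  moreover have "0 < L 1" by (simp add: L_pos)
  moreover have "eventually (\<lambda>y::real. y \<in> {0<..<1}) (at_right 0)"
    by (intro eventually_at_right_real) simp
  then have "eventually (\<lambda>y. L 1 * norm (y powr 2) \<le> norm (L y) \<and> norm (L y) \<le> E * norm (y powr 2)) (at_right 0)"
    by eventually_elim (use E L1 L_pos in \<open>simp add: less_imp_le\<close>)
  ultimately show ?thesis by (intro bigthetaI') auto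
qed

section \<open>Layer-cake formula and power-law tails\<close>

definition tail :: "real \<Rightarrow> real" where "tail s = prob {\<omega> \<in> space M. W \<omega> > s}"

lemma layer_cake:
  fixes p :: "real \<Rightarrow> ennreal"
  assumes [measurable]: "p \<in> borel_measurable borel"
  shows "(\<integral>\<^sup>+\<omega>. (\<integral>\<^sup>+s. p s * (if s < W \<omega> then 1 else 0) \<partial>lborel) \<partial>M) = (\<integral>\<^sup>+s. p s * ennreal (tail s) \<partial>lborel)"
proof -
  interpret P: pair_sigma_finite M lborel ..
  have "(\<integral>\<^sup>+\<omega>. (\<integral>\<^sup>+s. p s * (if s < W \<omega> then 1 else 0) \<partial>lborel) \<partial>M) =
      (\<integral>\<^sup>+s. (\<integral>\<^sup>+\<omega>. p s * (if s < W \<omega> then 1 else 0) \<partial>M) \<partial>lborel)"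
    by (rule P.Fubini'[symmetric]) measurable
  also have "\<dots> = (\<integral>\<^sup>+s. p s * ennreal (tail s) \<partial>lborel)"
  proof (rule nn_integral_cong)
    fix s
    have "(\<integral>\<^sup>+\<omega>. p s * (if s < W \<omega> then 1 else 0) \<partial>M) = (\<integral>\<^sup>+\<omega>. p s * indicator {\<omega> \<in> space M. W \<omega> > s} \<omega> \<partial>M)"
      by (intro nn_integral_cong) (auto split: split_indicator)
    also have "\<dots> = p s * ennreal (tail s)"
      by (subst nn_integral_cmult) (auto simp: tail_def emeasure_eq_measure)
    finally show "(\<integral>\<^sup>+\<omega>. p s * (if s < W \<omega> then 1 else 0) \<partial>M) = p s * ennreal (tail s)" .
  qed
  finally show ?thesis .
qed

text \<open>The derivative of \<open>w \<mapsto> w\<^sup>2 * min 1 ((w * m)\<^sup>2)\<close>, up to the null set \<open>{1 / m}\<close>.\<close>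

definition layer :: "real \<Rightarrow> real \<Rightarrow> ennreal" where
  "layer m s = ennreal (4 * m\<^sup>2 * s ^ 3) * indicator {0..1 / m} s + ennreal (2 * s) * indicator {1 / m..} s"

lemma layer_measurable [measurable]: "layer m \<in> borel_measurable borel"
  unfolding layer_def by measurable

lemma integral_layer:
  assumes "0 < m" "0 < w"
  shows "(\<integral>\<^sup>+s. layer m s * (if s < w then 1 else 0) \<partial>lborel) = ennreal (w\<^sup>2 * min 1 ((w * m)\<^sup>2))"
proof -
  define A where "A = 1 / m"
  have A: "0 < A" "m * A = 1" using assms by (auto simp: A_def)
  have i1: "(\<integral>\<^sup>+s. ennreal (4 * m\<^sup>2 * s ^ 3) * indicator {0..v} s \<partial>lborel) = ennreal (m\<^sup>2 * v ^ 4)" if "0 \<le> v" for v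
    using that by (subst nn_integral_FTC_Icc[where F = "\<lambda>s. m\<^sup>2 * s ^ 4"])
       (auto intro!: derivative_eq_intros simp: eval_nat_numeral)
  have i2: "(\<integral>\<^sup>+s. ennreal (2 * s) * indicator {A..v} s \<partial>lborel) = ennreal (v\<^sup>2 - A\<^sup>2)" if "A \<le> v" for v
    using that A by (subst nn_integral_FTC_Icc[where F = "\<lambda>s. s\<^sup>2"]) (auto intro!: derivative_eq_intros)
  show ?thesis
  proof (cases "w \<le> A")
    case True
    \<comment> \<open>The point \<open>w\<close> is a null set to discard: the condition s < w is
      strict, whereas the interval on the right is closed.\<close>
    have "(\<integral>\<^sup>+s. layer m s * (if s < w then 1 else 0) \<partial>lborel) =
        (\<integral>\<^sup>+s. ennreal (4 * m\<^sup>2 * s ^ 3) * indicator {0..w} s \<partial>lborel)"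
      using AE_lborel_singleton[of w] True
      by (intro nn_integral_cong_AE) (auto elim!: eventually_mono simp: layer_def A_def[symmetric] split: split_indicator)
    also have "\<dots> = ennreal (m\<^sup>2 * w ^ 4)" using assms by (simp add: i1)
    also have "w * m \<le> 1" using True assms by (simp add: A_def field_simps)
    then have "(w * m)\<^sup>2 \<le> 1" using assms by (simp add: power_le_one)
    then have "m\<^sup>2 * w ^ 4 = w\<^sup>2 * min 1 ((w * m)\<^sup>2)"
      by (simp add: min_def eval_nat_numeral mult_ac)
    finally show ?thesis .
  next
    case False
    have "(\<integral>\<^sup>+s. layer m s * (if s < w then 1 else 0) \<partial>lborel) =
        (\<integral>\<^sup>+s. ennreal (4 * m\<^sup>2 * s ^ 3) * indicator {0..A} s + ennreal (2 * s) * indicator {A..w} s \<partial>lborel)"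
      using AE_lborel_singleton[of w] False
      by (intro nn_integral_cong_AE) (auto elim!: eventually_mono simp: layer_def A_def[symmetric] split: split_indicator)
    also have "\<dots> = ennreal (m\<^sup>2 * A ^ 4) + ennreal (w\<^sup>2 - A\<^sup>2)"
      using A False by (subst nn_integral_add) (auto simp: i1 i2)
    also have "m\<^sup>2 * A ^ 4 = (m * A)\<^sup>2 * A\<^sup>2" by (simp add: eval_nat_numeral)
    also have "\<dots> = A\<^sup>2" using A by simp
    also have "ennreal (A\<^sup>2) + ennreal (w\<^sup>2 - A\<^sup>2) = ennreal (w\<^sup>2)"
      using A False by (subst ennreal_plus[symmetric]) (auto intro: power_mono)
    also have "1 \<le> w * m" using False assms by (simp add: A_def field_simps)
    then have "w\<^sup>2 = w\<^sup>2 * min 1 ((w * m)\<^sup>2)"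
      by (simp add: min_def one_le_power)
    finally show ?thesis .
  qed
qed

lemma L_layer:
  assumes "0 < m"
  shows "ennreal (L m) = (\<integral>\<^sup>+s. layer m s * ennreal (tail s) \<partial>lborel)"
proof -
  have "ennreal (L m) = (\<integral>\<^sup>+\<omega>. ennreal (W \<omega> ^ 2 * min 1 ((W \<omega> * m)\<^sup>2)) \<partial>M)"
    unfolding L_def by (intro nn_integral_eq_integral[symmetric] integrable_L) auto
  also have "\<dots> = (\<integral>\<^sup>+\<omega>. (\<integral>\<^sup>+s. layer m s * (if s < W \<omega> then 1 else 0) \<partial>lborel) \<partial>M)"
    using assms W_pos by (intro nn_integral_cong) (simp add: integral_layer)
  finally show ?thesis by (simp add: layer_cake)
qed

lemma tail_le_1: "tail s \<le> 1" and tail_nonneg: "0 \<le> tail s"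
  by (simp_all add: tail_def)

text \<open>Three ranges: up to \<open>w1\<close> the tail is at most 1; on [w1, 1/m] the integrand
  is of order m^2 s^(4-\<tau>); beyond 1/m the integral converges because \<tau> > 3. The
  antiderivative \<open>F\<close> is a parameter, being a power for \<tau> < 5 and a logarithm for
  \<tau> = 5.\<close>

lemma L_upper:
  assumes tail: "\<And>s. w1 \<le> s \<Longrightarrow> tail s \<le> D * s powr (- (\<tau> - 1))"
    and w1: "0 < w1" and D: "0 \<le> D" and \<tau>: "3 < \<tau>"
    and F: "\<And>s. w1 \<le> s \<Longrightarrow> (F has_real_derivative s powr (4 - \<tau>)) (at s)"
    and m: "0 < m" "w1 \<le> 1 / m"
  shows "L m \<le> m\<^sup>2 * w1 ^ 4 + 4 * m\<^sup>2 * D * (F (1 / m) - F w1) + 2 * D * m powr (\<tau> - 3) / (\<tau> - 3)"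
proof -
  define A where "A = 1 / m"
  have A: "0 < A" "w1 \<le> A" using m by (auto simp: A_def)
  let ?g1 = "\<lambda>s. ennreal (4 * m\<^sup>2 * s ^ 3) * indicator {0..w1} s"
  let ?g2 = "\<lambda>s. ennreal (4 * m\<^sup>2 * D * s powr (4 - \<tau>)) * indicator {w1..A} s"
  let ?g3 = "\<lambda>s. ennreal (2 * D * s powr (2 - \<tau>)) * indicator {A..} s"
  have "layer m s * ennreal (tail s) \<le> ?g1 s + ?g2 s + ?g3 s" for s
  proof -
    have 1: "4 * m\<^sup>2 * s ^ 3 * tail s \<le> 4 * m\<^sup>2 * s ^ 3" if "0 \<le> s"
      using that tail_le_1[of s] by (intro mult_left_le) auto
    have 2: "4 * m\<^sup>2 * s ^ 3 * tail s \<le> 4 * m\<^sup>2 * D * s powr (4 - \<tau>)" if "w1 \<le> s"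
    proof -
      have s: "0 < s" using that w1 by simp
      have "4 * m\<^sup>2 * s ^ 3 * tail s \<le> 4 * m\<^sup>2 * s ^ 3 * (D * s powr (- (\<tau> - 1)))"
        using that tail[OF that] s by (intro mult_left_mono) auto
      also have "\<dots> = 4 * m\<^sup>2 * D * (s powr 3 * s powr (- (\<tau> - 1)))"
        using s by simp
      also have "s powr 3 * s powr (- (\<tau> - 1)) = s powr (4 - \<tau>)"
        by (simp flip: powr_add)
      finally show ?thesis .
    qed
    have 3: "2 * s * tail s \<le> 2 * D * s powr (2 - \<tau>)" if "w1 \<le> s"
    proof -
      have s: "0 < s" using that w1 by simp
      have "2 * s * tail s \<le> 2 * s * (D * s powr (- (\<tau> - 1)))"
        using that tail[OF that] s by (intro mult_left_mono) auto
      also have "\<dots> = 2 * D * (s powr 1 * s powr (- (\<tau> - 1)))"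
        using s by simp
      also have "s powr 1 * s powr (- (\<tau> - 1)) = s powr (2 - \<tau>)"
        unfolding powr_add[symmetric] by simp
      finally show ?thesis .
    qed
    have "ennreal (4 * m\<^sup>2 * s ^ 3) * indicator {0..A} s * ennreal (tail s) \<le> ?g1 s + ?g2 s"
    proof (cases "s \<in> {0..A}")
      case True
      then have "ennreal (4 * m\<^sup>2 * s ^ 3) * indicator {0..A} s * ennreal (tail s) = ennreal (4 * m\<^sup>2 * s ^ 3 * tail s)"
        using tail_nonneg by (simp flip: ennreal_mult)
      also have "\<dots> \<le> ?g1 s + ?g2 s"
      proof (cases "s \<le> w1")
        case le: True
        then have "ennreal (4 * m\<^sup>2 * s ^ 3 * tail s) \<le> ?g1 s"
          using 1 True by (auto intro!: ennreal_leI)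
        then show ?thesis by (rule order.trans) simp
      next
        case False
        then have "ennreal (4 * m\<^sup>2 * s ^ 3 * tail s) \<le> ?g2 s"
          using 2 True by (auto intro!: ennreal_leI)
        then show ?thesis by (rule order.trans) simp
      qed
      finally show ?thesis .
    qed simp
    moreover have "ennreal (2 * s) * indicator {A..} s * ennreal (tail s) \<le> ?g3 s"
    proof (cases "A \<le> s")
      case True
      then have "ennreal (2 * s) * indicator {A..} s * ennreal (tail s) = ennreal (2 * s * tail s)"
        using tail_nonneg A by (simp flip: ennreal_mult)
      then show ?thesis using True 3 A by (auto intro!: ennreal_leI)
    qed simp
    ultimately show ?thesis
      unfolding layer_def A_def[symmetric] distrib_right by (rule add_mono)
  qed
  then have "ennreal (L m) \<le> (\<integral>\<^sup>+s. ?g1 s + ?g2 s + ?g3 s \<partial>lborel)"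
    unfolding L_layer[OF m(1)] by (intro nn_integral_mono)
  also have "\<dots> = (\<integral>\<^sup>+s. ?g1 s \<partial>lborel) + (\<integral>\<^sup>+s. ?g2 s \<partial>lborel) + (\<integral>\<^sup>+s. ?g3 s \<partial>lborel)"
    by (simp add: nn_integral_add)
  also have "(\<integral>\<^sup>+s. ?g1 s \<partial>lborel) = ennreal (m\<^sup>2 * w1 ^ 4)"
    using w1 by (subst nn_integral_FTC_Icc[where F = "\<lambda>s. m\<^sup>2 * s ^ 4"])
       (auto intro!: derivative_eq_intros simp: eval_nat_numeral)
  also have "(\<integral>\<^sup>+s. ?g2 s \<partial>lborel) = ennreal (4 * m\<^sup>2 * D * (F A - F w1))"
  proof (subst nn_integral_FTC_Icc[where F = "\<lambda>s. 4 * m\<^sup>2 * D * F s"])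
    show "((\<lambda>s. 4 * m\<^sup>2 * D * F s) has_real_derivative 4 * m\<^sup>2 * D * s powr (4 - \<tau>)) (at s)"
      if "s \<in> {w1..A}" for s
      using that by (intro DERIV_cmult F) simp
  qed (use A(2) D in \<open>auto simp: right_diff_distrib\<close>)
  also have "(\<integral>\<^sup>+s. ?g3 s \<partial>lborel) = ennreal (2 * D * A powr (3 - \<tau>) / (\<tau> - 3))"
  proof (subst nn_integral_FTC_atLeast[where F = "\<lambda>s. 2 * D / (3 - \<tau>) * s powr (3 - \<tau>)" and T = 0])
    have "((\<lambda>s. s powr (3 - \<tau>)) \<longlongrightarrow> 0) at_top"
      using \<tau> by (intro tendsto_neg_powr filterlim_ident) auto
    from tendsto_mult_right_zero[OF this]
    show "((\<lambda>s. 2 * D / (3 - \<tau>) * s powr (3 - \<tau>)) \<longlongrightarrow> 0) at_top" .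
    show "((\<lambda>s. 2 * D / (3 - \<tau>) * s powr (3 - \<tau>)) has_real_derivative 2 * D * s powr (2 - \<tau>)) (at s)" if "A \<le> s" for s
      using DERIV_cmult[OF has_real_derivative_powr[of s "3 - \<tau>"], of "2 * D / (3 - \<tau>)"] that A \<tau> by (simp add: mult.assoc)
    have "2 * D / (3 - \<tau>) = - (2 * D / (\<tau> - 3))"
      by (metis minus_diff_eq minus_divide_right)
    then have "0 - 2 * D / (3 - \<tau>) * A powr (3 - \<tau>) = 2 * D * A powr (3 - \<tau>) / (\<tau> - 3)" by simp
    then show "ennreal (0 - 2 * D / (3 - \<tau>) * A powr (3 - \<tau>)) = ennreal (2 * D * A powr (3 - \<tau>) / (\<tau> - 3))"
      by (rule arg_cong)
  qed (use D in auto)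
  finally have le: "ennreal (L m) \<le> ennreal (m\<^sup>2 * w1 ^ 4) + ennreal (4 * m\<^sup>2 * D * (F A - F w1)) + ennreal (2 * D * A powr (3 - \<tau>) / (\<tau> - 3))" .
  \<comment> \<open>Since \<open>ennreal\<close> truncates negative numbers, the estimate returns to
    the reals only once every summand is known to be nonnegative.\<close>
  have FA: "F w1 \<le> F A"
  proof (rule DERIV_nonneg_imp_nondecreasing[OF A(2)])
    fix s assume "w1 \<le> s"
    then show "\<exists>y. (F has_real_derivative y) (at s) \<and> 0 \<le> y"
      using F[of s] by (intro exI[of _ "s powr (4 - \<tau>)"]) auto
  qed
  have "L m \<le> m\<^sup>2 * w1 ^ 4 + 4 * m\<^sup>2 * D * (F A - F w1) + 2 * D * A powr (3 - \<tau>) / (\<tau> - 3)"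
  proof -
    have nonneg: "0 \<le> m\<^sup>2 * w1 ^ 4" "0 \<le> 4 * m\<^sup>2 * D * (F A - F w1)" "0 \<le> 2 * D * A powr (3 - \<tau>) / (\<tau> - 3)"
      using FA D \<tau> w1 by auto
    show ?thesis
      using le by (simp only: nonneg add_nonneg_nonneg ennreal_plus[symmetric] ennreal_le_iff)
  qed
  also have "A powr (3 - \<tau>) = m powr (\<tau> - 3)"
    using m(1) by (simp add: A_def powr_divide powr_minus_divide[symmetric])
  finally show ?thesis unfolding A_def .
qed

text \<open>Only the middle range is kept; at \<tau> = 5 it is the one that produces the
  logarithm.\<close>

lemma L_lower:
  assumes tail: "\<And>s. w1 \<le> s \<Longrightarrow> D * s powr (- (\<tau> - 1)) \<le> tail s"
    and w1: "0 < w1" and D: "0 \<le> D"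
    and F: "\<And>s. w1 \<le> s \<Longrightarrow> (F has_real_derivative s powr (4 - \<tau>)) (at s)"
    and m: "0 < m" "w1 \<le> 1 / m"
  shows "4 * m\<^sup>2 * D * (F (1 / m) - F w1) \<le> L m"
proof -
  have "ennreal (4 * m\<^sup>2 * D * (F (1 / m) - F w1)) =
      (\<integral>\<^sup>+s. ennreal (4 * m\<^sup>2 * D * s powr (4 - \<tau>)) * indicator {w1..1 / m} s \<partial>lborel)"
  proof (subst nn_integral_FTC_Icc[where F = "\<lambda>s. 4 * m\<^sup>2 * D * F s"])
    show "((\<lambda>s. 4 * m\<^sup>2 * D * F s) has_real_derivative 4 * m\<^sup>2 * D * s powr (4 - \<tau>)) (at s)"
      if "s \<in> {w1..1 / m}" for s
      using that by (intro DERIV_cmult F) simp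
  qed (use m(2) D in \<open>auto simp: right_diff_distrib\<close>)
  also have "\<dots> \<le> ennreal (L m)"
    unfolding L_layer[OF m(1)]
  proof (rule nn_integral_mono)
    fix s
    show "ennreal (4 * m\<^sup>2 * D * s powr (4 - \<tau>)) * indicator {w1..1 / m} s \<le> layer m s * ennreal (tail s)"
    proof (cases "s \<in> {w1..1 / m}")
      case True
      then have s: "0 < s" using w1 by simp
      have "s powr (4 - \<tau>) = s powr 3 * s powr (- (\<tau> - 1))" by (simp flip: powr_add)
      then have "4 * m\<^sup>2 * D * s powr (4 - \<tau>) = 4 * m\<^sup>2 * s ^ 3 * (D * s powr (- (\<tau> - 1)))"
        using s by simp
      also have "\<dots> \<le> 4 * m\<^sup>2 * s ^ 3 * tail s"
        using True tail s by (intro mult_left_mono) auto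
      finally have "ennreal (4 * m\<^sup>2 * D * s powr (4 - \<tau>)) \<le> ennreal (4 * m\<^sup>2 * s ^ 3) * ennreal (tail s)"
        using s tail_nonneg by (simp add: ennreal_leI flip: ennreal_mult)
      also have "\<dots> \<le> layer m s * ennreal (tail s)"
        using True s by (intro mult_right_mono) (auto simp: layer_def)
      finally show ?thesis using True by simp
    qed simp
  qed
  finally show ?thesis using L_pos[OF m(1)] by (simp add: ennreal_le_iff)
qed

text \<open>A Markov-type bound from the event W > 1/m, where the truncation equals 1. It has the
  right order for \<tau> < 5, but at \<tau> = 5 it misses the logarithm.\<close>

lemma L_lower_tail:
  assumes m: "0 < m"
  shows "(1 / m)\<^sup>2 * tail (1 / m) \<le> L m"
proof -
  have "(1 / m)\<^sup>2 * tail (1 / m) = (\<integral>\<omega>. (1 / m)\<^sup>2 * indicator {\<omega> \<in> space M. W \<omega> > 1 / m} \<omega> \<partial>M)"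
    by (simp add: tail_def)
  also have "\<dots> \<le> L m"
    unfolding L_def
  proof (intro integral_mono integrable_L)
    fix \<omega> assume w: "\<omega> \<in> space M"
    show "(1 / m)\<^sup>2 * indicator {\<omega> \<in> space M. W \<omega> > 1 / m} \<omega> \<le> (W \<omega>)\<^sup>2 * min 1 ((W \<omega> * m)\<^sup>2)"
    proof (cases "W \<omega> > 1 / m")
      case True
      then have "1 \<le> W \<omega> * m" using m by (simp add: field_simps)
      then have "min 1 ((W \<omega> * m)\<^sup>2) = 1" by (simp add: min_def one_le_power)
      moreover have "(1 / m)\<^sup>2 \<le> (W \<omega>)\<^sup>2" using True m by (intro power_mono) auto
      ultimately show ?thesis using w True by simp
    qed simp
  qed (intro integrable_mult_right integrable_real_indicator, auto simp: emeasure_eq_measure)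
  finally show ?thesis .
qed

lemma power_law_tailE:
  assumes "power_law_tail M W \<tau>"
  obtains c' C' w1 where "0 < c'" "0 < C'" "1 < w1"
    "\<And>s. w1 \<le> s \<Longrightarrow> c' * s powr (- (\<tau> - 1)) \<le> tail s"
    "\<And>s. w1 \<le> s \<Longrightarrow> tail s \<le> C' * s powr (- (\<tau> - 1))"
proof -
  obtain c' C' w0 where "0 < c'" "c' < C'" "1 < w0"
    "\<And>w. w0 < w \<Longrightarrow> c' * w powr (- (\<tau> - 1)) \<le> tail w"
    "\<And>w. w0 < w \<Longrightarrow> tail w \<le> C' * w powr (- (\<tau> - 1))"
    using assms unfolding power_law_tail_def tail_def by blast
  then show ?thesis by (intro that[of c' C' "w0 + 1"]) auto
qed

lemma L_bigtheta_power_law: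
  assumes \<tau>: "3 < \<tau>" "\<tau> < 5" and "power_law_tail M W \<tau>"
  shows "L \<in> \<Theta>[at_right 0](\<lambda>y. y powr (\<tau> - 3))"
proof -
  obtain c' C' w1 where w: "0 < c'" "0 < C'" "1 < w1"
    "\<And>s. w1 \<le> s \<Longrightarrow> c' * s powr (- (\<tau> - 1)) \<le> tail s"
    "\<And>s. w1 \<le> s \<Longrightarrow> tail s \<le> C' * s powr (- (\<tau> - 1))"
    using power_law_tailE[OF assms(3)] by blast
  define D where "D = w1 ^ 4 + 4 * C' / (5 - \<tau>) + 2 * C' / (\<tau> - 3)"
  have D: "0 < D" unfolding D_def using w \<tau> by (intro add_pos_pos divide_pos_pos) auto
  have "eventually (\<lambda>m::real. m \<in> {0<..<1 / w1}) (at_right 0)"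
    using w by (intro eventually_at_right_real) simp
  then have "eventually (\<lambda>m. c' * norm (m powr (\<tau> - 3)) \<le> norm (L m) \<and> norm (L m) \<le> D * norm (m powr (\<tau> - 3))) (at_right 0)"
  proof eventually_elim
    case (elim m)
    then have m: "0 < m" "w1 \<le> 1 / m" using w by (auto simp: field_simps)
    have "1 / w1 \<le> 1" using w by simp
    then have m1: "m \<le> 1" using elim by simp
    have m2: "m\<^sup>2 = m powr 2" using m by (simp add: powr_numeral)
    have inv: "(1 / m) powr x = m powr (- x)" for x using m by (simp add: powr_divide powr_minus_divide)
    have "L m \<le> m\<^sup>2 * w1 ^ 4 + 4 * m\<^sup>2 * C' * ((1 / m) powr (5 - \<tau>) / (5 - \<tau>) - w1 powr (5 - \<tau>) / (5 - \<tau>))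
       + 2 * C' * m powr (\<tau> - 3) / (\<tau> - 3)"
    proof (rule L_upper[where F = "\<lambda>s. s powr (5 - \<tau>) / (5 - \<tau>)", OF w(5) _ _ \<tau>(1) _ m])
      fix s assume "w1 \<le> s"
      then show "((\<lambda>s. s powr (5 - \<tau>) / (5 - \<tau>)) has_real_derivative s powr (4 - \<tau>)) (at s)"
        using \<tau> w DERIV_cmult[OF has_real_derivative_powr[of s "5 - \<tau>"], of "1 / (5 - \<tau>)"] by simp
    qed (use w in auto)
    also have "\<dots> \<le> m\<^sup>2 * w1 ^ 4 + 4 * m\<^sup>2 * C' * ((1 / m) powr (5 - \<tau>) / (5 - \<tau>))
       + 2 * C' * m powr (\<tau> - 3) / (\<tau> - 3)"
      using w \<tau> by (intro add_mono mult_left_mono) auto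
    also have "4 * m\<^sup>2 * C' * ((1 / m) powr (5 - \<tau>) / (5 - \<tau>)) = 4 * C' / (5 - \<tau>) * (m powr 2 * m powr (- (5 - \<tau>)))"
      unfolding m2 inv by simp
    also have "m powr 2 * m powr (- (5 - \<tau>)) = m powr (\<tau> - 3)" by (simp flip: powr_add)
    \<comment> \<open>As \<tau> - 3 < 2 and m \<le> 1, the square is the smaller power. The three
      summands of \<open>D\<close> match the three ranges of \<open>L_upper\<close>.\<close>
    also have "m\<^sup>2 * w1 ^ 4 \<le> m powr (\<tau> - 3) * w1 ^ 4"
      unfolding m2 using m m1 \<tau> w by (intro mult_right_mono powr_mono') auto
    finally have u: "L m \<le> D * m powr (\<tau> - 3)" by (simp add: D_def algebra_simps)
    have "c' * m powr (\<tau> - 3) = (1 / m)\<^sup>2 * (c' * (1 / m) powr (- (\<tau> - 1)))"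
    proof -
      have "(1 / m)\<^sup>2 * (1 / m) powr (- (\<tau> - 1)) = (1 / m) powr (2 + - (\<tau> - 1))"
        using m unfolding powr_add by (simp add: powr_numeral)
      also have "2 + - (\<tau> - 1) = - (\<tau> - 3)" by simp
      also have "(1 / m) powr (- (\<tau> - 3)) = m powr (\<tau> - 3)"
        by (simp only: inv minus_minus)
      finally show ?thesis by simp
    qed
    also have "\<dots> \<le> (1 / m)\<^sup>2 * tail (1 / m)" using w(4)[OF m(2)] by (intro mult_left_mono) auto
    also have "\<dots> \<le> L m" by (rule L_lower_tail[OF m(1)])
    finally show ?case using u L_pos[OF m(1)] by simp
  qed
  then show ?thesis by (intro bigthetaI'[OF w(1) D])
qed

lemma L_bigtheta_power_law_5:
  assumes "power_law_tail M W 5"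
  shows "L \<in> \<Theta>[at_right 0](\<lambda>y. y powr 2 * ln (1 / y))"
proof -
  obtain c' C' w1 where w: "0 < c'" "0 < C'" "1 < w1"
    "\<And>s. w1 \<le> s \<Longrightarrow> c' * s powr (- (5 - 1)) \<le> tail s"
    "\<And>s. w1 \<le> s \<Longrightarrow> tail s \<le> C' * s powr (- (5 - 1))"
    using power_law_tailE[OF assms] by blast
  define D where "D = w1 ^ 4 + 4 * C' + C'"
  have D: "0 < D" unfolding D_def using w by (intro add_pos_pos) auto
  have F: "(ln has_real_derivative s powr (4 - 5)) (at s)" if "w1 \<le> s" for s
    using that w by (auto intro!: derivative_eq_intros simp: powr_minus_divide)
  have "eventually (\<lambda>m::real. m \<in> {0<..<1 / w1}) (at_right 0)"
    using w by (intro eventually_at_right_real) simp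
  \<comment> \<open>The first condition leaves at least half of the logarithm after subtracting
    \<open>ln w1\<close>; the second lets the terms without logarithm be absorbed.\<close>
  moreover have "eventually (\<lambda>m. 2 * ln w1 \<le> ln (1 / m) \<and> 1 \<le> ln (1 / m)) (at_right 0)"
    unfolding eventually_conj_iff by (intro conjI; real_asymp)
  ultimately have "eventually (\<lambda>m. (2 * c') * norm (m powr 2 * ln (1 / m)) \<le> norm (L m) \<and>
      norm (L m) \<le> D * norm (m powr 2 * ln (1 / m))) (at_right 0)"
  proof eventually_elim
    case (elim m)
    then have m: "0 < m" "w1 \<le> 1 / m" using w by (auto simp: field_simps)
    have m2: "m\<^sup>2 = m powr 2" using m by (simp add: powr_numeral)
    have "L m \<le> m\<^sup>2 * w1 ^ 4 + 4 * m\<^sup>2 * C' * (ln (1 / m) - ln w1) + 2 * C' * m powr (5 - 3) / (5 - 3)"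
      by (rule L_upper[OF w(5) _ _ _ F m]) (use w in auto)
    also have "\<dots> = m\<^sup>2 * w1 ^ 4 + 4 * m\<^sup>2 * C' * (ln (1 / m) - ln w1) + C' * m\<^sup>2"
      using m by (simp add: powr_numeral)
    also have "\<dots> \<le> m\<^sup>2 * w1 ^ 4 * ln (1 / m) + 4 * m\<^sup>2 * C' * ln (1 / m) + C' * m\<^sup>2 * ln (1 / m)"
    proof (intro add_mono)
      show "m\<^sup>2 * w1 ^ 4 \<le> m\<^sup>2 * w1 ^ 4 * ln (1 / m)"
        using elim w mult_left_mono[of 1 "ln (1 / m)" "m\<^sup>2 * w1 ^ 4"] by simp
      show "4 * m\<^sup>2 * C' * (ln (1 / m) - ln w1) \<le> 4 * m\<^sup>2 * C' * ln (1 / m)"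
        using w by (intro mult_left_mono) auto
      show "C' * m\<^sup>2 \<le> C' * m\<^sup>2 * ln (1 / m)"
        using elim w mult_left_mono[of 1 "ln (1 / m)" "C' * m\<^sup>2"] by simp
    qed
    finally have u: "L m \<le> D * (m powr 2 * ln (1 / m))" by (simp add: D_def algebra_simps m2)
    have "2 * c' * (m powr 2 * ln (1 / m)) = 4 * m\<^sup>2 * c' * (ln (1 / m) / 2)" by (simp add: m2)
    also have "\<dots> \<le> 4 * m\<^sup>2 * c' * (ln (1 / m) - ln w1)"
      using elim w by (intro mult_left_mono) auto
    also have "\<dots> \<le> L m"
      by (rule L_lower[OF w(4) _ _ F m]) (use w in auto)
    finally have l: "2 * c' * (m powr 2 * ln (1 / m)) \<le> L m" .
    have "0 \<le> ln (1 / m)" using elim by linarith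
    then have "0 \<le> m powr 2 * ln (1 / m)" by (rule mult_nonneg_nonneg[OF powr_ge_zero])
    then have "norm (m powr 2 * ln (1 / m)) = m powr 2 * ln (1 / m)"
      unfolding real_norm_def by (rule abs_of_nonneg)
    moreover have "norm (L m) = L m" using L_pos[OF m(1)] by simp
    ultimately show ?case using l u by (simp only:)
  qed
  then show ?thesis using w D by (intro bigthetaI'[of "2 * c'" D]) auto
qed

end

section \<open>Application to the Beta law\<close>

context sym_beta_law
begin

lemma deriv_log_mgf:
  "(deriv ^^ 1) (log_mgf (sym_beta b)) = f"
  "(deriv ^^ 2) (log_mgf (sym_beta b)) = f1"
  "(deriv ^^ 3) (log_mgf (sym_beta b)) = f2"
  "(deriv ^^ 4) (log_mgf (sym_beta b)) = f3"
  by (simp_all add: eval_nat_numeral deriv_eqI[OF DERIV_log_mgf] deriv_eqI[OF DERIV_f]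
      deriv_eqI[OF DERIV_f1] deriv_eqI[OF DERIV_f2])

lemma less_4_cases: "k < 4 \<Longrightarrow> k = 0 \<or> k = 1 \<or> k = 2 \<or> k = (3::nat)"
  by auto

text \<open>As \<open>deriv\<close> is a total operator, this certifies that the iterated
  derivatives in the statement are genuine.\<close>

lemma log_mgf_differentiable:
  assumes "k < 4"
  shows "(deriv ^^ k) (log_mgf (sym_beta b)) field_differentiable at t"
proof -
  have "log_mgf (sym_beta b) field_differentiable at t" "f field_differentiable at t"
    "f1 field_differentiable at t" "f2 field_differentiable at t"
    unfolding field_differentiable_def using DERIV_log_mgf DERIV_f DERIV_f1 DERIV_f2 by blast+
  then show ?thesis using less_4_cases[OF assms] deriv_log_mgf by (elim disjE) simp_all
qed

lemma log_mgf_derivs_at_0: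
  assumes "k < 4"
  shows "\<not> (deriv ^^ k) (log_mgf (sym_beta b)) 0 < 0"
proof -
  have "log_mgf (sym_beta b) 0 = 0"
    by (simp add: log_mgf_def prob_space)
  then show ?thesis
    using less_4_cases[OF assms] deriv_log_mgf f_0 f1_0 f2_0 \<kappa>_pos by (elim disjE) simp_all
qed

text \<open>The constant \<open>\<kappa>\<close> occurs twice because it is both the slope at 0 and
  the constant of \<open>defect_upper\<close>.\<close>

lemma mean_field_sym_beta:
  assumes "prob_space M" "W \<in> borel_measurable M" "\<forall>\<omega>\<in>space M. 0 < W \<omega>" "integrable M (\<lambda>\<omega>. W \<omega> ^ 2)"
  shows "mean_field M W f \<kappa> defect_const \<kappa>"
  using assms continuous_on_f f_pos f_le_1 f_ratio_decreasing \<kappa>_pos defect_const_pos defect_lower defect_upper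
  by (intro mean_field.intro mean_field_axioms.intro) auto

end

theorem proposition5p8:
  fixes b :: real and M :: "'w measure" and W :: "'w \<Rightarrow> real"
  assumes "b > 0"
  shows
    "(\<forall>k<4. \<forall>t. (deriv ^^ k) (log_mgf (sym_beta b)) field_differentiable at t) \<and>
     (\<forall>t>0. (deriv ^^ 3) (log_mgf (sym_beta b)) t < 0) \<and>
     ((deriv ^^ 4) (log_mgf (sym_beta b)) 0 < 0 \<and>
       (\<forall>k<4. \<not> (deriv ^^ k) (log_mgf (sym_beta b)) 0 < 0)) \<and>
     (prob_space M \<and> W \<in> borel_measurable M \<and> (\<forall>\<omega>\<in>space M. 0 < W \<omega>) \<and>
      integrable M (\<lambda>\<omega>. W \<omega> ^ 2) \<and>
      (integrable M (\<lambda>\<omega>. W \<omega> ^ 4) \<or> (\<exists>\<tau>. 3 < \<tau> \<and> \<tau> \<le> 5 \<and> power_law_tail M W \<tau>))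
      \<longrightarrow>
      (let \<alpha> = sym_beta b; \<theta>c = theta_c \<alpha> M W; mp = m_plus \<alpha> M W in
        (\<forall>\<theta>>\<theta>c. \<exists>!m. 0 < m \<and> m / \<theta> = phi \<alpha> M W 0 m) \<and>
        (\<forall>h>0. \<forall>\<theta>>0. \<exists>!m. 0 \<le> m \<and> m / \<theta> = phi \<alpha> M W h m) \<and>
        (integrable M (\<lambda>\<omega>. W \<omega> ^ 4) \<longrightarrow>
          (\<lambda>\<theta>. mp \<theta> 0) \<in> \<Theta>[at_right \<theta>c](\<lambda>\<theta>. (\<theta> - \<theta>c) powr (1 / 2)) \<and>
          (\<lambda>h. mp \<theta>c h) \<in> \<Theta>[at_right 0](\<lambda>h. h powr (1 / 3))) \<and>
        (\<forall>\<tau>. 3 < \<tau> \<and> \<tau> < 5 \<and> power_law_tail M W \<tau> \<longrightarrow>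
          (\<lambda>\<theta>. mp \<theta> 0) \<in> \<Theta>[at_right \<theta>c](\<lambda>\<theta>. (\<theta> - \<theta>c) powr (1 / (\<tau> - 3))) \<and>
          (\<lambda>h. mp \<theta>c h) \<in> \<Theta>[at_right 0](\<lambda>h. h powr (1 / (\<tau> - 2)))) \<and>
        (power_law_tail M W 5 \<longrightarrow>
          (\<lambda>\<theta>. mp \<theta> 0) \<in> \<Theta>[at_right \<theta>c](\<lambda>\<theta>. ((\<theta> - \<theta>c) / ln (1 / (\<theta> - \<theta>c))) powr (1 / 2)) \<and>
          (\<lambda>h. mp \<theta>c h) \<in> \<Theta>[at_right 0](\<lambda>h. (h / ln (1 / h)) powr (1 / 3)))))"
  (is "?smooth \<and> ?neg \<and> ?zero \<and> (?hyps \<longrightarrow> ?concl)")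
proof (intro conjI impI)
  interpret B: sym_beta_law b by unfold_locales fact
  show ?smooth using B.log_mgf_differentiable by blast
  show ?neg unfolding B.deriv_log_mgf using B.f2_neg by blast
  show "(deriv ^^ 4) (log_mgf (sym_beta b)) 0 < 0" unfolding B.deriv_log_mgf by (rule B.f3_0)
  show "\<forall>k<4. \<not> (deriv ^^ k) (log_mgf (sym_beta b)) 0 < 0" using B.log_mgf_derivs_at_0 by blast
  assume hyps: ?hyps
  then interpret mean_field M W B.f B.\<kappa> B.defect_const B.\<kappa>
    by (intro B.mean_field_sym_beta) auto
  have mean1: "(\<integral>\<sigma>. \<sigma> * exp (t * \<sigma>) \<partial>sym_beta b) / (\<integral>\<sigma>. exp (t * \<sigma>) \<partial>sym_beta b) = B.f t" for t
    by (simp add: B.f_def B.mean_def tilted_moment_def)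
  have phi: "phi (sym_beta b) M W = \<Phi>"
    by (intro ext) (simp add: phi_def sb_expectation_def mean1 \<Phi>_def \<mu>_def)
  have "(\<integral>\<sigma>. \<sigma>\<^sup>2 \<partial>sym_beta b) = B.\<kappa>"
    using B.mean_0(2) by (simp add: B.mean_def B.mom_0_0) (simp add: tilted_moment_def)
  \<comment> \<open>The size-biased mean of W is E[W^2] / E[W], which turns the two expressions for
    the critical value into each other.\<close>
  then have theta: "theta_c (sym_beta b) M W = \<theta>c"
    by (simp add: theta_c_def sb_expectation_def \<theta>c_def \<mu>_def power2_eq_square)
  have spont_eq: "(\<lambda>\<theta>. m_plus (sym_beta b) M W \<theta> 0) = spont"
    by (intro ext) (simp add: m_plus_def phi spont_def)
  \<comment> \<open>Only an eventual equality is claimed: at h = 0 the definition of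
    \<open>m_plus\<close> switches to strictly positive solutions, while \<open>crit\<close> does
    not.\<close>
  have "eventually (\<lambda>h. crit h = m_plus (sym_beta b) M W \<theta>c h) (at_right 0)"
    using eventually_at_right_less[of 0] by eventually_elim (simp add: m_plus_def phi crit_def)
  then have crit_eq: "(\<lambda>h. m_plus (sym_beta b) M W \<theta>c h) \<in> \<Theta>[at_right 0](g)"
    if "crit \<in> \<Theta>[at_right 0](g)" for g
    using that landau_theta.in_cong by blast
  show ?concl
    unfolding Let_def phi theta spont_eq
  proof (intro conjI allI impI)
    show "\<exists>!m. 0 < m \<and> m / \<theta> = \<Phi> 0 m" if "\<theta>c < \<theta>" for \<theta>
      using that by (rule ex1_fixed_point_zero_field)
    show "\<exists>!m. 0 \<le> m \<and> m / \<theta> = \<Phi> h m" if "0 < h" "0 < \<theta>" for h \<theta>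
      using that by (rule ex1_fixed_point_field)
    assume "integrable M (\<lambda>\<omega>. W \<omega> ^ 4)"
    note L = L_bigtheta_fourth_moment[OF this]
    show "spont \<in> \<Theta>[at_right \<theta>c](\<lambda>\<theta>. (\<theta> - \<theta>c) powr (1 / 2))"
      using spont_powr[OF _ L] by simp
    show "m_plus (sym_beta b) M W \<theta>c \<in> \<Theta>[at_right 0](\<lambda>h. h powr (1 / 3))"
      using crit_powr[OF _ L] by (intro crit_eq) simp
  next
    fix \<tau> assume \<tau>: "3 < \<tau> \<and> \<tau> < 5 \<and> power_law_tail M W \<tau>"
    then have L: "L \<in> \<Theta>[at_right 0](\<lambda>y. y powr (\<tau> - 3))" by (intro L_bigtheta_power_law) auto
    show "spont \<in> \<Theta>[at_right \<theta>c](\<lambda>\<theta>. (\<theta> - \<theta>c) powr (1 / (\<tau> - 3)))"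
      using spont_powr[OF _ L] \<tau> by simp
    show "m_plus (sym_beta b) M W \<theta>c \<in> \<Theta>[at_right 0](\<lambda>h. h powr (1 / (\<tau> - 2)))"
      using crit_powr[OF _ L] \<tau> by (intro crit_eq) simp
  next
    assume "power_law_tail M W 5"
    note L = L_bigtheta_power_law_5[OF this]
    show "spont \<in> \<Theta>[at_right \<theta>c](\<lambda>\<theta>. ((\<theta> - \<theta>c) / ln (1 / (\<theta> - \<theta>c))) powr (1 / 2))"
      using spont_powr_ln[OF _ L] by simp
    show "m_plus (sym_beta b) M W \<theta>c \<in> \<Theta>[at_right 0](\<lambda>h. (h / ln (1 / h)) powr (1 / 3))"
      using crit_powr_ln[OF _ L] by (intro crit_eq) simp
  qed
qed

end
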